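(* Let $\mathcal{A}$ be a unital Banach algebra over $\mathbb{C}$ and $\varphi:\mathcal{A}\to\mathbb{C}$ a continuous linear functional with $\varphi(1)=1$. Let $(a_1,b_1)$ and $(a_2,b_2)$ be two-faced pairs of non-commutative random variables in $(\mathcal{A},\varphi)$ which are bi-free, and assume $\varphi(a_1)\neq 0$, $\varphi(a_2)\neq 0$, $\varphi(b_1)\neq 0$, $\varphi(b_2)\neq 0$. Then for all $(z,w)\in(\mathbb{C}\setminus\{0\})^2$ sufficiently close to $(0,0)$, $$S_{a_1a_2,\,b_1b_2}(z,w)=S_{a_1,b_1}(z,w)\,S_{a_2,b_2}(z,w).$$
   Context: A two-faced pair $(a,b)$ in $(\mathcal{A},\varphi)$ is an ordered pair of elements of $\mathcal{A}$, with $a$ regarded as the left variable and $b$ as the right variable. Transforms. For $a,b\in\mathcal{A}$ and $t,s\in\mathbb{C}$ near $0$ put $h_a(t)=\varphi((1-ta)^{-1})$, $\psi_a(t)=h_a(t)-1$, and $H_{a,b}(t,s)=\varphi((1-ta)^{-1}(1-sb)^{-1})$. If $\varphi(a)\ne0$, then $\psi_a(0)=0$, $\psi_a'(0)=\varphi(a)\neq0$, and $\mathcal{X}_a$ denotes the holomorphic inverse function of $\psi_a$ in a neighborhood of $0$ (with $\mathcal{X}_a(0)=0$). If $\varphi(a)\neq0$ and $\varphi(b)\ne0$, the $2$-variables partial bi-free $S$-transform is, for $(z,w)\in(\mathbb{C}\setminus\{0\})^2$ near $(0,0)$, $$S_{a,b}(z,w)=\frac{z+1}{z}\,\frac{w+1}{w}\left(1-\frac{1+z+w}{H_{a,b}(\mathcal{X}_a(z),\mathcal{X}_b(w))}\right).$$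 Bi-freeness. A vector space with specified state vector is a triple $(X,X^\circ,\xi)$ with $X$ a complex vector space, $X=\mathbb{C}\xi\oplus X^\circ$, $\xi\ne 0$. Let $p:X\to\mathbb{C}$ be linear with $p(\xi)=1$, $\ker p=X^\circ$, and for a linear operator $T\in\mathcal{L}(X)$ let $\varphi_\xi(T)=p(T\xi)$. The free product of $(X_k,X_k^\circ,\xi_k)$, $k=1,2$, is $(X,X^\circ,\xi)$ with $X^\circ=\bigoplus_{n\ge1}\bigoplus_{k_1\ne k_2\neq\cdots\ne k_n}X_{k_1}^\circ\otimes\cdots\otimes X_{k_n}^\circ$ and $X=\mathbb{C}\xi\oplus X^\circ$. Let $X(\ell,k)$ (resp. $X(r,k)$) be the direct sum of $\mathbb{C}\xi$ and those summands with $k_1\ne k$ (resp. $k_n\neq k$). There are natural isomorphisms $V_k:X_k\otimes X(\ell,k)\to X$ and $W_k:X(r,k)\otimes X_k\to X$, given by concatenation of tensors with $\xi_k$ and $\xi$ treated as empty tensors ($\xi_k\otimes\xi\mapsto\xi$, etc.). For $T\in\mathcal{L}(X_k)$ put $\lambda_k(T)=V_k(T\otimes I)V_k^{-1}$ and $\rho_k(T)=W_k(I\otimes T)W_k^{-1}$. The two-faced pairs $(a_1,b_1)$, $(a_2,b_2)$ in $(\mathcal{A},\varphi)$ are bi-free if there exist vector spaces with specified state vectors $(X_k,X_k^\circ,\xi_k)$ and operators $L_k,R_k\in\mathcal{L}(X_k)$, $k=1,2$, such that the joint distribution (all non-commutative moments) of $(a_1,b_1,a_2,b_2)$ with respect to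 $\varphi$ equals the joint distribution of $(\lambda_1(L_1),\rho_1(R_1),\lambda_2(L_2),\rho_2(R_2))$ with respect to $\varphi_\xi$ on the free product. *)

theory Defs
  imports "HOL-Analysis.Analysis" "HOL-Library.Function_Algebras"
begin

section \<open>Complex vector spaces and complex Banach algebras\<close>

class complex_vector = ab_group_add +
  fixes scaleC :: "complex \<Rightarrow> 'a \<Rightarrow> 'a" (infixr "*\<^sub>C" 75)
  assumes scaleC_add_right: "c *\<^sub>C (x + y) = c *\<^sub>C x + c *\<^sub>C y"
    and scaleC_add_left: "(c + d) *\<^sub>C x = c *\<^sub>C x + d *\<^sub>C x"
    and scaleC_scaleC: "c *\<^sub>C d *\<^sub>C x = (c * d) *\<^sub>C x"
    and scaleC_one: "1 *\<^sub>C x = x"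

global_interpretation complex_vector:
  vector_space "scaleC :: complex \<Rightarrow> 'a \<Rightarrow> 'a::complex_vector"
  by unfold_locales (rule scaleC_add_right scaleC_add_left scaleC_scaleC scaleC_one)+

instantiation complex :: complex_vector
begin
definition scaleC_complex_def [simp]: "c *\<^sub>C (z :: complex) = c * z"
instance by standard (simp_all add: algebra_simps)
end

instantiation "fun" :: (type, complex_vector) complex_vector
begin
definition scaleC_fun_def: "c *\<^sub>C f = (\<lambda>x. c *\<^sub>C f x)"
instance
  by standard
    (simp_all add: scaleC_fun_def fun_eq_iff scaleC_add_right scaleC_add_left scaleC_scaleC scaleC_one)
end

class complex_banach_algebra_1 = banach + real_normed_algebra_1 + complex_vector +
  assumes scaleR_scaleC: "r *\<^sub>R x = complex_of_real r *\<^sub>C x"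
    and mult_scaleC_left: "(c *\<^sub>C x) * y = c *\<^sub>C (x * y)"
    and mult_scaleC_right: "x * (c *\<^sub>C y) = c *\<^sub>C (x * y)"
    and norm_scaleC: "norm (c *\<^sub>C x) = cmod c * norm x"

section \<open>Transforms\<close>

definition alg_inverse :: "'a::monoid_mult \<Rightarrow> 'a" where
  "alg_inverse x = (THE y. x * y = 1 \<and> y * x = 1)"

definition h_transform :: "('a::complex_banach_algebra_1 \<Rightarrow> complex) \<Rightarrow> 'a \<Rightarrow> complex \<Rightarrow> complex" where
  "h_transform \<phi> a t = \<phi> (alg_inverse (1 - t *\<^sub>C a))"

definition psi_transform :: "('a::complex_banach_algebra_1 \<Rightarrow> complex) \<Rightarrow> 'a \<Rightarrow> complex \<Rightarrow> complex" where
  "psi_transform \<phi> a t = h_transform \<phi> a t - 1"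

definition H_transform ::
    "('a::complex_banach_algebra_1 \<Rightarrow> complex) \<Rightarrow> 'a \<Rightarrow> 'a \<Rightarrow> complex \<Rightarrow> complex \<Rightarrow> complex" where
  "H_transform \<phi> a b t s = \<phi> (alg_inverse (1 - t *\<^sub>C a) * alg_inverse (1 - s *\<^sub>C b))"

text \<open>Only the germ at 0 of the inverse function is determined; the choice below fixes one
  representative of it.\<close>

definition local_inverse_at_0 :: "(complex \<Rightarrow> complex) \<Rightarrow> (complex \<Rightarrow> complex) \<Rightarrow> bool" where
  "local_inverse_at_0 f g \<longleftrightarrow>
     g analytic_on {0} \<and> g 0 = 0 \<and>
     (\<forall>\<^sub>F z in nhds 0. f (g z) = z) \<and> (\<forall>\<^sub>F t in nhds 0. g (f t) = t)"

definition chi_transform :: "('a::complex_banach_algebra_1 \<Rightarrow> complex) \<Rightarrow> 'a \<Rightarrow> complex \<Rightarrow> complex" where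
  "chi_transform \<phi> a = (SOME g. local_inverse_at_0 (psi_transform \<phi> a) g)"

definition S_transform ::
    "('a::complex_banach_algebra_1 \<Rightarrow> complex) \<Rightarrow> 'a \<Rightarrow> 'a \<Rightarrow> complex \<Rightarrow> complex \<Rightarrow> complex" where
  "S_transform \<phi> a b z w =
     (z + 1) / z * ((w + 1) / w) *
     (1 - (1 + z + w) / H_transform \<phi> a b (chi_transform \<phi> a z) (chi_transform \<phi> b w))"

section \<open>Vector spaces with specified state vector\<close>

definition linear_operator_on :: "'v::complex_vector set \<Rightarrow> ('v \<Rightarrow> 'v) \<Rightarrow> bool" where
  "linear_operator_on V T \<longleftrightarrow>
     (\<forall>x\<in>V. T x \<in> V) \<and> (\<forall>x\<in>V. \<forall>y\<in>V. T (x + y) = T x + T y) \<and> (\<forall>c. \<forall>x\<in>V. T (c *\<^sub>C x) = c *\<^sub>C T x)"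

definition pointed_space :: "'v::complex_vector set \<Rightarrow> 'v set \<Rightarrow> 'v \<Rightarrow> bool" where
  "pointed_space V V0 \<xi> \<longleftrightarrow>
     complex_vector.subspace V \<and> complex_vector.subspace V0 \<and> \<xi> \<noteq> 0 \<and>
     V = {c *\<^sub>C \<xi> + y |c y. y \<in> V0} \<and> complex_vector.span {\<xi>} \<inter> V0 = {0}"

text \<open>On \<open>V\<close>, \<open>state_coord V0 \<xi>\<close> is the functional with value 1 at \<open>\<xi>\<close> and kernel \<open>V0\<close>.\<close>

definition state_coord :: "'v::complex_vector set \<Rightarrow> 'v \<Rightarrow> 'v \<Rightarrow> complex" where
  "state_coord V0 \<xi> x = (THE c. x - c *\<^sub>C \<xi> \<in> V0)"

definition vector_state :: "'v::complex_vector set \<Rightarrow> 'v \<Rightarrow> ('v \<Rightarrow> 'v) \<Rightarrow> complex" where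
  "vector_state V0 \<xi> T = state_coord V0 \<xi> (T \<xi>)"

section \<open>Algebraic tensor products\<close>

text \<open>The algebraic tensor product of two subspaces is realised as the space of functionals on
  bilinear forms spanned by the evaluations at pairs of vectors. Functionals are normalised to vanish
  at arguments that are not bilinear forms.\<close>

definition bilinear_form :: "'v::complex_vector set \<Rightarrow> 'w::complex_vector set \<Rightarrow> ('v \<Rightarrow> 'w \<Rightarrow> complex) \<Rightarrow> bool" where
  "bilinear_form V W B \<longleftrightarrow>
     (\<forall>x\<in>V. \<forall>x'\<in>V. \<forall>y\<in>W. B (x + x') y = B x y + B x' y) \<and>
     (\<forall>x\<in>V. \<forall>y\<in>W. \<forall>y'\<in>W. B x (y + y') = B x y + B x y') \<and>
     (\<forall>c. \<forall>x\<in>V. \<forall>y\<in>W. B (c *\<^sub>C x) y = c * B x y \<and> B x (c *\<^sub>C y) = c * B x y)"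

type_synonym ('v, 'w) tensor = "('v \<Rightarrow> 'w \<Rightarrow> complex) \<Rightarrow> complex"

definition tensor :: "'v::complex_vector set \<Rightarrow> 'w::complex_vector set \<Rightarrow> 'v \<Rightarrow> 'w \<Rightarrow> ('v, 'w) tensor" where
  "tensor V W x y = (\<lambda>B. if bilinear_form V W B then B x y else 0)"

definition tensor_space :: "'v::complex_vector set \<Rightarrow> 'w::complex_vector set \<Rightarrow> ('v, 'w) tensor set" where
  "tensor_space V W = complex_vector.span {tensor V W x y |x y. x \<in> V \<and> y \<in> W}"

text \<open>\<open>tensor_lift G\<close> is the linear map sending the tensor of \<open>x\<close> and \<open>y\<close> to \<open>G x y\<close>, for a bilinear
  map \<open>G\<close> into functionals; \<open>tensor_map V W S T\<close> is the tensor product of the operators \<open>S\<close> on \<open>V\<close> and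
  \<open>T\<close> on \<open>W\<close>.\<close>

definition tensor_lift :: "('v \<Rightarrow> 'w \<Rightarrow> 'f \<Rightarrow> complex) \<Rightarrow> ('v, 'w) tensor \<Rightarrow> 'f \<Rightarrow> complex" where
  "tensor_lift G \<Phi> = (\<lambda>f. \<Phi> (\<lambda>x y. G x y f))"

definition tensor_map ::
    "'v::complex_vector set \<Rightarrow> 'w::complex_vector set \<Rightarrow> ('v \<Rightarrow> 'v) \<Rightarrow> ('w \<Rightarrow> 'w) \<Rightarrow>
     ('v, 'w) tensor \<Rightarrow> ('v, 'w) tensor" where
  "tensor_map V W S T = tensor_lift (\<lambda>x y. tensor V W (S x) (T y))"

section \<open>The free product of two vector spaces with specified state vectors\<close>

text \<open>The two spaces are subspaces \<open>X 1\<close> and \<open>X 2\<close> of one ambient complex vector space. This is no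
  restriction, since any two spaces embed into their direct sum.\<close>

type_synonym 'v word = "(nat \<times> 'v) list"
type_synonym 'v word_tensor = "('v word \<Rightarrow> complex) \<Rightarrow> complex"

locale free_product =
  fixes X X0 :: "nat \<Rightarrow> 'v::complex_vector set" and \<xi> :: "nat \<Rightarrow> 'v"
  assumes pointed: "k \<in> {1, 2} \<Longrightarrow> pointed_space (X k) (X0 k) (\<xi> k)"
begin

definition words :: "'v word set" where
  "words = {u. (\<forall>(k, x)\<in>set u. k \<in> {1, 2} \<and> x \<in> X0 k) \<and> distinct_adj (map fst u)}"

text \<open>A family of multilinear forms, one on \<open>X0 k\<^sub>1 \<times> \<dots> \<times> X0 k\<^sub>n\<close> for each alternating sequence
  of indices, written as a single function on words. Hence the span of the evaluations at all words is
  the direct sum, over the alternating index sequences, of the tensor products of the \<open>X0 k\<^sub>i\<close>. The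
  evaluation at the empty word spans the summand of the state vector.\<close>

definition multilinear_form :: "('v word \<Rightarrow> complex) \<Rightarrow> bool" where
  "multilinear_form F \<longleftrightarrow>
     (\<forall>u v k x y. u @ (k, x) # v \<in> words \<and> u @ (k, y) # v \<in> words \<longrightarrow>
        F (u @ (k, x + y) # v) = F (u @ (k, x) # v) + F (u @ (k, y) # v)) \<and>
     (\<forall>u v k c x. u @ (k, x) # v \<in> words \<longrightarrow> F (u @ (k, c *\<^sub>C x) # v) = c * F (u @ (k, x) # v))"

definition word_tensor :: "'v word \<Rightarrow> 'v word_tensor" where
  "word_tensor u = (\<lambda>F. if multilinear_form F then F u else 0)"

definition free_space :: "'v word_tensor set" where
  "free_space = complex_vector.span (word_tensor ` words)"

definition free_space0 :: "'v word_tensor set" where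
  "free_space0 = complex_vector.span (word_tensor ` {u \<in> words. u \<noteq> []})"

definition free_vector :: "'v word_tensor" where
  "free_vector = word_tensor []"

definition left_words :: "nat \<Rightarrow> 'v word set" where
  "left_words k = {u \<in> words. u = [] \<or> fst (hd u) \<noteq> k}"

definition right_words :: "nat \<Rightarrow> 'v word set" where
  "right_words k = {u \<in> words. u = [] \<or> fst (last u) \<noteq> k}"

definition left_space :: "nat \<Rightarrow> 'v word_tensor set" where
  "left_space k = complex_vector.span (word_tensor ` left_words k)"

definition right_space :: "nat \<Rightarrow> 'v word_tensor set" where
  "right_space k = complex_vector.span (word_tensor ` right_words k)"

definition coord :: "nat \<Rightarrow> 'v \<Rightarrow> complex" where
  "coord k = state_coord (X0 k) (\<xi> k)"

definition centred :: "nat \<Rightarrow> 'v \<Rightarrow> 'v" where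
  "centred k x = x - coord k x *\<^sub>C \<xi> k"

text \<open>For \<open>y\<close> in \<open>X0 k\<close>, \<open>attach_left k y\<close> is the linear map on \<open>left_space k\<close> which puts the tensor factor
  \<open>y\<close> in front, and \<open>attach_right k y\<close> is its mirror image on \<open>right_space k\<close>.\<close>

definition attach_left :: "nat \<Rightarrow> 'v \<Rightarrow> 'v word_tensor \<Rightarrow> 'v word_tensor" where
  "attach_left k y \<eta> =
     (\<lambda>F. if multilinear_form F then \<eta> (\<lambda>u. if u \<in> left_words k then F ((k, y) # u) else 0) else 0)"

definition attach_right :: "nat \<Rightarrow> 'v \<Rightarrow> 'v word_tensor \<Rightarrow> 'v word_tensor" where
  "attach_right k y \<eta> =
     (\<lambda>F. if multilinear_form F then \<eta> (\<lambda>u. if u \<in> right_words k then F (u @ [(k, y)]) else 0) else 0)"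

definition left_iso :: "nat \<Rightarrow> ('v, 'v word_tensor) tensor \<Rightarrow> 'v word_tensor" where
  "left_iso k = tensor_lift (\<lambda>x \<eta>. coord k x *\<^sub>C \<eta> + attach_left k (centred k x) \<eta>)"

definition right_iso :: "nat \<Rightarrow> ('v word_tensor, 'v) tensor \<Rightarrow> 'v word_tensor" where
  "right_iso k = tensor_lift (\<lambda>\<eta> x. coord k x *\<^sub>C \<eta> + attach_right k (centred k x) \<eta>)"

definition left_rep :: "nat \<Rightarrow> ('v \<Rightarrow> 'v) \<Rightarrow> 'v word_tensor \<Rightarrow> 'v word_tensor" where
  "left_rep k T =
     left_iso k \<circ> tensor_map (X k) (left_space k) T id \<circ>
     inv_into (tensor_space (X k) (left_space k)) (left_iso k)"

definition right_rep :: "nat \<Rightarrow> ('v \<Rightarrow> 'v) \<Rightarrow> 'v word_tensor \<Rightarrow> 'v word_tensor" where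
  "right_rep k T =
     right_iso k \<circ> tensor_map (right_space k) (X k) id T \<circ>
     inv_into (tensor_space (right_space k) (X k)) (right_iso k)"

end

section \<open>Bi-freeness\<close>

text \<open>Existence of the two vector spaces cannot be quantified over all types inside HOL, so the type
  of the ambient space containing them is a parameter. A theorem assuming \<open>bi_free TYPE('v)\<close> for a free
  type variable \<open>'v\<close> covers all complex vector spaces. Positions 0, 1, 2, 3 stand for
  \<open>a\<^sub>1\<close>, \<open>b\<^sub>1\<close>, \<open>a\<^sub>2\<close>, \<open>b\<^sub>2\<close>, and the lists \<open>is\<close> run through all non-commutative monomials.\<close>

definition bi_free ::
    "'v::complex_vector itself \<Rightarrow> ('a::monoid_mult \<Rightarrow> complex) \<Rightarrow> 'a \<times> 'a \<Rightarrow> 'a \<times> 'a \<Rightarrow> bool" where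
  "bi_free TYPE('v) \<phi> p q \<longleftrightarrow>
     (\<exists>(X :: nat \<Rightarrow> 'v set) X0 \<xi> L R.
        free_product X X0 \<xi> \<and>
        (\<forall>k\<in>{1, 2}. linear_operator_on (X k) (L k) \<and> linear_operator_on (X k) (R k)) \<and>
        (\<forall>is. set is \<subseteq> {..<4} \<longrightarrow>
           \<phi> (prod_list (map (nth [fst p, snd p, fst q, snd q]) is)) =
           vector_state (free_product.free_space0 X0) (free_product.free_vector X0)
             (foldr (\<circ>)
               (map (nth [free_product.left_rep X X0 \<xi> 1 (L 1), free_product.right_rep X X0 \<xi> 1 (R 1),
                          free_product.left_rep X X0 \<xi> 2 (L 2), free_product.right_rep X X0 \<xi> 2 (R 2)]) is)
               id)))"

end

theory Submission
  imports Defs "HOL-Complex_Analysis.Complex_Analysis"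
begin

text \<open>Write \<open>c = z / (1 + z)\<close> and \<open>d = w / (1 + w)\<close>. The normalised resolvents
  \<open>(1 - \<X>(z) a\<^sub>i)\<inverse> / (1 + z) = 1 + p\<^sub>i\<close> and \<open>(1 - \<X>(w) b\<^sub>i)\<inverse> / (1 + w) = 1 + q\<^sub>i\<close> have centred
  \<open>p\<^sub>i\<close>, \<open>q\<^sub>i\<close>. A purely algebraic identity, valid for any \<open>a\<^sub>1\<close>, \<open>a\<^sub>2\<close>, expresses the resolvent of
  the product through them: for \<open>t = \<X>\<^sub>1(z) \<X>\<^sub>2(z) / c\<close>,
  \<open>(1 - t a\<^sub>1 a\<^sub>2)\<inverse> = (1 + z) (1 + p\<^sub>2) (1 - p\<^sub>1 p\<^sub>2 / c)\<inverse> (1 + p\<^sub>1)\<close>.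
  Expanding the inverse gives every alternating word in \<open>p\<^sub>1\<close>, \<open>p\<^sub>2\<close> exactly once. On the free product
  of the vector spaces, an alternating word in the \<open>q\<close>s creates a tensor that an alternating word in
  the \<open>p\<close>s annihilates letter by letter, so bi-freeness makes these words orthogonal, with diagonal
  values the products of the \<open>Q\<^sub>i = \<phi>(p\<^sub>i q\<^sub>i)\<close>. Hence \<open>t\<close> is the value at \<open>z\<close> of the inverse function for
  \<open>a\<^sub>1 a\<^sub>2\<close>, and summing a geometric series gives
  \<open>H / ((1 + z) (1 + w)) = (1 + Q\<^sub>1) (1 + Q\<^sub>2) / (1 - Q\<^sub>1 Q\<^sub>2 / (c d))\<close>
  for the product pair, against \<open>1 + Q\<^sub>i\<close> for the factors. The claim is then a rational identity.\<close>

text \<open>Bi-freeness speaks of polynomials in the variables, while the \<open>p\<^sub>i\<close>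
  and \<open>q\<^sub>i\<close> are limits of polynomials. A polynomial in one variable still acts on
  the free product through a single operator on its space, so orthogonality is proved for centred
  polynomials and carried to the resolvents by continuity. To compute with \<open>left_rep\<close>
  and \<open>right_rep\<close>, concatenation has to be injective on the tensor product. Since
  tensors are functionals on bilinear forms, this follows once every bilinear form on the two
  factors comes from a multilinear form on words. The expansion converges because
  \<open>p\<^sub>1 p\<^sub>2\<close> is of order \<open>z^2\<close> near 0, while \<open>c\<close>
  is of order \<open>z\<close>. For the same reason \<open>t\<close> tends to 0, which is needed
  because the inverse function inverts only near 0. That the product
  \<open>a\<^sub>1 a\<^sub>2\<close> has an inverse function at all rests on \<open>\<phi>(a\<^sub>1
  a\<^sub>2) = \<phi>(a\<^sub>1) \<phi>(a\<^sub>2)\<close>, again a consequence of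
  orthogonality.\<close>

lemma scaleC_fun_apply [simp]: "(c *\<^sub>C f) x = c *\<^sub>C f x"
  by (simp add: scaleC_fun_def)

section \<open>Operators transported along a bilinear map\<close>

lemma tensor_lift_linear:
  "tensor_lift G (\<Phi> + \<Psi>) = tensor_lift G \<Phi> + tensor_lift G \<Psi>"
  "tensor_lift G (c *\<^sub>C \<Phi>) = c *\<^sub>C tensor_lift G \<Phi>"
  "tensor_lift G 0 = 0"
  by (simp_all add: tensor_lift_def fun_eq_iff)

lemma tensor_lift_tensor:
  assumes "\<And>f. bilinear_form V W (\<lambda>x y. G x y f)"
  shows "tensor_lift G (tensor V W x y) = G x y"
  using assms by (simp add: tensor_lift_def tensor_def)

lemma tensor_map_tensor:
  assumes "linear_operator_on V S" "linear_operator_on W T"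
  shows "tensor_map V W S T (tensor V W x y) = tensor V W (S x) (T y)"
proof -
  have "bilinear_form V W (\<lambda>x y. tensor V W (S x) (T y) f)" for f
  proof (cases "bilinear_form V W f")
    case True
    then have "(\<lambda>x y. tensor V W (S x) (T y) f) = (\<lambda>x y. f (S x) (T y))"
      by (simp add: tensor_def)
    with True assms show ?thesis
      by (simp add: bilinear_form_def linear_operator_on_def)
  next
    case False
    then have "(\<lambda>x y. tensor V W (S x) (T y) f) = (\<lambda>x y. 0)"
      by (simp add: tensor_def)
    then show ?thesis
      by (simp add: bilinear_form_def)
  qed
  then show ?thesis
    unfolding tensor_map_def by (rule tensor_lift_tensor)
qed

text \<open>An element of \<open>tensor_space V W\<close> is determined by its values at bilinear
  forms. By \<open>separating\<close>, each such value can be read off from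
  \<open>tensor_lift G\<close> at some \<open>f\<close>, so \<open>tensor_lift G\<close> is
  injective and the inverse used in \<open>transport\<close> is a genuine one.\<close>

locale tensor_iso =
  fixes V :: "'v::complex_vector set" and W :: "'w::complex_vector set"
    and G :: "'v \<Rightarrow> 'w \<Rightarrow> 'f \<Rightarrow> complex"
  assumes bilinear: "bilinear_form V W (\<lambda>x y. G x y f)"
    and separating: "bilinear_form V W B \<Longrightarrow> \<exists>f. \<forall>x\<in>V. \<forall>y\<in>W. G x y f = B x y"
begin

definition transport :: "('v \<Rightarrow> 'v) \<Rightarrow> ('w \<Rightarrow> 'w) \<Rightarrow> ('f \<Rightarrow> complex) \<Rightarrow> 'f \<Rightarrow> complex" where
  "transport S T =
     tensor_lift G \<circ> tensor_map V W S T \<circ> inv_into (tensor_space V W) (tensor_lift G)"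

definition range_space :: "('f \<Rightarrow> complex) set" where
  "range_space = complex_vector.span {G x y |x y. x \<in> V \<and> y \<in> W}"

lemma tensor_lift_G: "tensor_lift G (tensor V W x y) = G x y"
  by (rule tensor_lift_tensor) (rule bilinear)

lemma tensor_in: "x \<in> V \<Longrightarrow> y \<in> W \<Longrightarrow> tensor V W x y \<in> tensor_space V W"
  unfolding tensor_space_def by (rule complex_vector.span_base) auto

lemma tensor_space_subspace: "complex_vector.subspace (tensor_space V W)"
  unfolding tensor_space_def by (rule complex_vector.subspace_span)

text \<open>The spanning tensors look at a form only at points of \<open>V\<close> and
  \<open>W\<close>, so agreement of \<open>G\<close> with \<open>B\<close> there suffices.\<close>

lemma tensor_space_eval:
  assumes "\<Phi> \<in> tensor_space V W" "\<And>x y. x \<in> V \<Longrightarrow> y \<in> W \<Longrightarrow> G x y f = B x y" "bilinear_form V W B"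
  shows "tensor_lift G \<Phi> f = \<Phi> B"
  using assms(1) unfolding tensor_space_def
proof (rule complex_vector.span_induct)
  show "complex_vector.subspace {\<Phi>. tensor_lift G \<Phi> f = \<Phi> B}"
    by (rule complex_vector.subspaceI) (simp_all add: tensor_lift_linear)
next
  fix \<Psi> assume "\<Psi> \<in> {tensor V W x y |x y. x \<in> V \<and> y \<in> W}"
  then obtain x y where "\<Psi> = tensor V W x y" "x \<in> V" "y \<in> W"
    by blast
  then show "tensor_lift G \<Psi> f = \<Psi> B"
    using assms(2,3) by (simp add: tensor_lift_G) (simp add: tensor_def)
qed

lemma tensor_space_not_bilinear:
  assumes "\<Phi> \<in> tensor_space V W" "\<not> bilinear_form V W B"
  shows "\<Phi> B = 0"
  using assms(1) unfolding tensor_space_def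
proof (rule complex_vector.span_induct)
  show "complex_vector.subspace {\<Phi>. \<Phi> B = (0::complex)}"
    by (rule complex_vector.subspaceI) simp_all
qed (use assms(2) in \<open>auto simp: tensor_def\<close>)

lemma inj_tensor_lift: "inj_on (tensor_lift G) (tensor_space V W)"
proof (rule inj_onI, rule ext)
  fix \<Phi> \<Psi> B
  assume *: "\<Phi> \<in> tensor_space V W" "\<Psi> \<in> tensor_space V W" "tensor_lift G \<Phi> = tensor_lift G \<Psi>"
  show "\<Phi> B = \<Psi> B"
  proof (cases "bilinear_form V W B")
    case True
    then obtain f where "\<forall>x\<in>V. \<forall>y\<in>W. G x y f = B x y"
      using separating by blast
    then show ?thesis
      using tensor_space_eval[OF *(1) _ True, of f] tensor_space_eval[OF *(2) _ True, of f] *(3) by simp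
  \<comment> \<open>At an argument that is not bilinear both values are 0 by the normalisation of
    \<open>tensor\<close>.\<close>
  qed (simp add: tensor_space_not_bilinear *)
qed

lemma range_space_subset: "range_space \<subseteq> tensor_lift G ` tensor_space V W"
proof
  note sub = tensor_space_subspace
  fix v assume "v \<in> range_space"
  then have "\<exists>\<Phi>\<in>tensor_space V W. v = tensor_lift G \<Phi>"
    unfolding range_space_def
  proof (rule complex_vector.span_induct)
    show "complex_vector.subspace {v. \<exists>\<Phi>\<in>tensor_space V W. v = tensor_lift G \<Phi>}"
    proof (rule complex_vector.subspaceI)
      show "0 \<in> {v. \<exists>\<Phi>\<in>tensor_space V W. v = tensor_lift G \<Phi>}"
        using complex_vector.subspace_0[OF sub] by (auto intro!: bexI[of _ 0] simp: tensor_lift_linear)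
    next
      fix v w
      assume "v \<in> {v. \<exists>\<Phi>\<in>tensor_space V W. v = tensor_lift G \<Phi>}"
        "w \<in> {v. \<exists>\<Phi>\<in>tensor_space V W. v = tensor_lift G \<Phi>}"
      then obtain \<Phi> \<Psi> where "\<Phi> \<in> tensor_space V W" "\<Psi> \<in> tensor_space V W"
          "v = tensor_lift G \<Phi>" "w = tensor_lift G \<Psi>"
        by blast
      then have "\<Phi> + \<Psi> \<in> tensor_space V W" "v + w = tensor_lift G (\<Phi> + \<Psi>)"
        using complex_vector.subspace_add[OF sub] by (simp_all only: tensor_lift_linear)
      then show "v + w \<in> {v. \<exists>\<Phi>\<in>tensor_space V W. v = tensor_lift G \<Phi>}"
        by blast
    next
      fix c v
      assume "v \<in> {v. \<exists>\<Phi>\<in>tensor_space V W. v = tensor_lift G \<Phi>}"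
      then obtain \<Phi> where "\<Phi> \<in> tensor_space V W" "v = tensor_lift G \<Phi>"
        by blast
      then have "c *\<^sub>C \<Phi> \<in> tensor_space V W" "c *\<^sub>C v = tensor_lift G (c *\<^sub>C \<Phi>)"
        using complex_vector.subspace_scale[OF sub] by (simp_all only: tensor_lift_linear)
      then show "c *\<^sub>C v \<in> {v. \<exists>\<Phi>\<in>tensor_space V W. v = tensor_lift G \<Phi>}"
        by blast
    qed
  next
    fix w assume "w \<in> {G x y |x y. x \<in> V \<and> y \<in> W}"
    then obtain x y where "w = G x y" "x \<in> V" "y \<in> W"
      by blast
    then show "\<exists>\<Phi>\<in>tensor_space V W. w = tensor_lift G \<Phi>"
      using tensor_in tensor_lift_G by metis
  qed
  then show "v \<in> tensor_lift G ` tensor_space V W"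
    by blast
qed

lemma transport_G:
  assumes "linear_operator_on V S" "linear_operator_on W T" "x \<in> V" "y \<in> W"
  shows "transport S T (G x y) = G (S x) (T y)"
proof -
  have "inv_into (tensor_space V W) (tensor_lift G) (G x y) = tensor V W x y"
    using inv_into_f_f[OF inj_tensor_lift tensor_in[OF assms(3,4)]]
    by (simp add: tensor_lift_G)
  then show ?thesis
    by (simp add: transport_def tensor_map_tensor assms tensor_lift_G)
qed

lemma range_space_cases:
  assumes "v \<in> range_space"
  obtains \<Phi> where "\<Phi> \<in> tensor_space V W" "v = tensor_lift G \<Phi>"
  using assms range_space_subset by blast

lemma transport_tensor_lift:
  assumes "\<Phi> \<in> tensor_space V W"
  shows "transport S T (tensor_lift G \<Phi>) = tensor_lift G (tensor_map V W S T \<Phi>)"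
  using inv_into_f_f[OF inj_tensor_lift assms] by (simp add: transport_def)

text \<open>Linearity is confined to \<open>range_space\<close>: outside the image of
  \<open>tensor_lift G\<close> the value of \<open>inv_into\<close> is arbitrary.\<close>

lemma transport_add:
  assumes "v \<in> range_space" "w \<in> range_space"
  shows "transport S T (v + w) = transport S T v + transport S T w"
proof -
  obtain \<Phi> \<Psi> where *: "\<Phi> \<in> tensor_space V W" "\<Psi> \<in> tensor_space V W"
      "v = tensor_lift G \<Phi>" "w = tensor_lift G \<Psi>"
    using assms range_space_cases by metis
  then show ?thesis
    using transport_tensor_lift[OF complex_vector.subspace_add[OF tensor_space_subspace *(1,2)]]
      transport_tensor_lift[OF *(1)] transport_tensor_lift[OF *(2)]
    by (simp only: tensor_lift_linear tensor_map_def)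
qed

lemma transport_scale:
  assumes "v \<in> range_space"
  shows "transport S T (c *\<^sub>C v) = c *\<^sub>C transport S T v"
proof -
  obtain \<Phi> where *: "\<Phi> \<in> tensor_space V W" "v = tensor_lift G \<Phi>"
    using assms range_space_cases by metis
  then show ?thesis
    using transport_tensor_lift[OF complex_vector.subspace_scale[OF tensor_space_subspace *(1)]]
      transport_tensor_lift[OF *(1)]
    by (simp only: tensor_lift_linear tensor_map_def)
qed

end

section \<open>Vector spaces with specified state vectors\<close>

lemma state_coord_unique:
  assumes "pointed_space V V0 \<xi>" "y \<in> V0"
  shows "state_coord V0 \<xi> (c *\<^sub>C \<xi> + y) = c"
  unfolding state_coord_def
proof (rule the_equality)
  show "c *\<^sub>C \<xi> + y - c *\<^sub>C \<xi> \<in> V0"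
    using assms(2) by simp
next
  fix d assume "c *\<^sub>C \<xi> + y - d *\<^sub>C \<xi> \<in> V0"
  moreover have sub: "complex_vector.subspace V0"
    and zero: "complex_vector.span {\<xi>} \<inter> V0 = {0}" and nz: "\<xi> \<noteq> 0"
    using assms(1) unfolding pointed_space_def by - (elim conjE, assumption)+
  ultimately have "c *\<^sub>C \<xi> + y - d *\<^sub>C \<xi> - y \<in> V0"
    using complex_vector.subspace_diff[OF sub _ assms(2)] by blast
  moreover have "c *\<^sub>C \<xi> + y - d *\<^sub>C \<xi> - y = (c - d) *\<^sub>C \<xi>"
    by (simp add: complex_vector.scale_left_diff_distrib)
  moreover have "(c - d) *\<^sub>C \<xi> \<in> complex_vector.span {\<xi>}"
    by (simp add: complex_vector.span_base complex_vector.span_scale)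
  ultimately have "(c - d) *\<^sub>C \<xi> = 0"
    using zero by (metis Int_iff singletonD)
  then show "d = c"
    using nz by simp
qed

context free_product
begin

lemma
  assumes "k \<in> {1, 2}"
  shows X_subspace: "complex_vector.subspace (X k)"
    and X0_subspace: "complex_vector.subspace (X0 k)"
    and X_eq: "X k = {c *\<^sub>C \<xi> k + y |c y. y \<in> X0 k}"
  using pointed[OF assms] unfolding pointed_space_def by - (elim conjE, assumption)+

lemma X_cases:
  assumes "k \<in> {1, 2}" "x \<in> X k"
  obtains c y where "x = c *\<^sub>C \<xi> k + y" "y \<in> X0 k"
  using assms(2) unfolding X_eq[OF assms(1)] by blast

lemma coord_decomp: "k \<in> {1, 2} \<Longrightarrow> y \<in> X0 k \<Longrightarrow> coord k (c *\<^sub>C \<xi> k + y) = c"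
  unfolding coord_def by (rule state_coord_unique[OF pointed])

lemma X_decomp: "k \<in> {1, 2} \<Longrightarrow> y \<in> X0 k \<Longrightarrow> c *\<^sub>C \<xi> k + y \<in> X k"
  using X_eq[of k] by blast

lemma X0_subset_X: "k \<in> {1, 2} \<Longrightarrow> y \<in> X0 k \<Longrightarrow> y \<in> X k"
  using X_decomp[of k y 0] by simp

lemma coord_X0: "k \<in> {1, 2} \<Longrightarrow> y \<in> X0 k \<Longrightarrow> coord k y = 0"
  using coord_decomp[of k y 0] by simp

lemma xi_in: "k \<in> {1, 2} \<Longrightarrow> \<xi> k \<in> X k"
  using X_decomp[of k 0 1] complex_vector.subspace_0[OF X0_subspace] by simp

lemma coord_xi: "k \<in> {1, 2} \<Longrightarrow> coord k (\<xi> k) = 1"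
  using coord_decomp[of k 0 1] complex_vector.subspace_0[OF X0_subspace] by simp

lemma centred_in:
  assumes "k \<in> {1, 2}" "x \<in> X k"
  shows "centred k x \<in> X0 k"
proof -
  obtain c y where "x = c *\<^sub>C \<xi> k + y" "y \<in> X0 k"
    using assms by (rule X_cases)
  then show ?thesis
    using assms(1) by (simp add: centred_def coord_decomp)
qed

lemma centred_xi: "k \<in> {1, 2} \<Longrightarrow> centred k (\<xi> k) = 0"
  by (simp add: centred_def coord_xi)

lemma centred_X0: "k \<in> {1, 2} \<Longrightarrow> y \<in> X0 k \<Longrightarrow> centred k y = y"
  by (simp add: centred_def coord_X0)

lemma coord_add:
  assumes "k \<in> {1, 2}" "x \<in> X k" "y \<in> X k"
  shows "coord k (x + y) = coord k x + coord k y"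
proof -
  obtain c x' d y' where "x = c *\<^sub>C \<xi> k + x'" "y = d *\<^sub>C \<xi> k + y'" "x' \<in> X0 k" "y' \<in> X0 k"
    using X_cases[OF assms(1,2)] X_cases[OF assms(1,3)] by metis
  moreover from this have "x + y = (c + d) *\<^sub>C \<xi> k + (x' + y')"
    by (simp add: scaleC_add_left)
  moreover have "x' + y' \<in> X0 k"
    using complex_vector.subspace_add[OF X0_subspace[OF assms(1)]] calculation by blast
  ultimately show ?thesis
    using coord_decomp[OF assms(1)] by metis
qed

lemma coord_scale:
  assumes "k \<in> {1, 2}" "x \<in> X k"
  shows "coord k (d *\<^sub>C x) = d * coord k x"
proof -
  obtain c x' where "x = c *\<^sub>C \<xi> k + x'" "x' \<in> X0 k"
    using assms by (rule X_cases)
  moreover from this have "d *\<^sub>C x = (d * c) *\<^sub>C \<xi> k + d *\<^sub>C x'"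
    by (simp add: scaleC_add_right scaleC_scaleC)
  moreover have "d *\<^sub>C x' \<in> X0 k"
    using complex_vector.subspace_scale[OF X0_subspace[OF assms(1)]] calculation by blast
  ultimately show ?thesis
    using coord_decomp[OF assms(1)] by metis
qed

lemma centred_add:
  "k \<in> {1, 2} \<Longrightarrow> x \<in> X k \<Longrightarrow> y \<in> X k \<Longrightarrow> centred k (x + y) = centred k x + centred k y"
  by (simp add: centred_def coord_add scaleC_add_left)

lemma centred_scale:
  "k \<in> {1, 2} \<Longrightarrow> x \<in> X k \<Longrightarrow> centred k (d *\<^sub>C x) = d *\<^sub>C centred k x"
  by (simp add: centred_def coord_scale complex_vector.scale_right_diff_distrib scaleC_scaleC)

section \<open>Words and word tensors\<close>

lemma Nil_in_words [simp]: "[] \<in> words"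
  and Nil_in_left_words [simp]: "[] \<in> left_words k"
  and Nil_in_right_words [simp]: "[] \<in> right_words k"
  by (auto simp: words_def left_words_def right_words_def)

lemma Cons_in_words: "(k, y) # u \<in> words \<longleftrightarrow> k \<in> {1, 2} \<and> y \<in> X0 k \<and> u \<in> left_words k"
  by (cases u) (auto simp: words_def left_words_def)

lemma snoc_in_words: "u @ [(k, y)] \<in> words \<longleftrightarrow> k \<in> {1, 2} \<and> y \<in> X0 k \<and> u \<in> right_words k"
  by (cases u rule: rev_cases) (auto simp: words_def right_words_def distinct_adj_append_iff)

lemma left_words_subset: "u \<in> left_words k \<Longrightarrow> u \<in> words"
  and right_words_subset: "u \<in> right_words k \<Longrightarrow> u \<in> words"
  by (auto simp: left_words_def right_words_def)

lemma letter_in_words: "u @ (j, x) # v \<in> words \<Longrightarrow> j \<in> {1, 2} \<and> x \<in> X0 j"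
  by (auto simp: words_def)

lemma words_letter: "u @ (j, x) # v \<in> words \<Longrightarrow> y \<in> X0 j \<Longrightarrow> u @ (j, y) # v \<in> words"
  by (auto simp: words_def)

lemma left_words_letter:
  "u @ (j, x) # v \<in> words \<Longrightarrow> y \<in> X0 j \<Longrightarrow>
     u @ (j, y) # v \<in> left_words k \<longleftrightarrow> u @ (j, x) # v \<in> left_words k"
  using words_letter[of u j x v y] by (cases u) (simp_all add: left_words_def)

lemma right_words_letter:
  "u @ (j, x) # v \<in> words \<Longrightarrow> y \<in> X0 j \<Longrightarrow>
     u @ (j, y) # v \<in> right_words k \<longleftrightarrow> u @ (j, x) # v \<in> right_words k"
  using words_letter[of u j x v y] by (cases v rule: rev_cases) (simp_all add: right_words_def)

lemma multilinear_formI: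
  assumes "\<And>u v k x y. \<lbrakk>u @ (k, x) # v \<in> words; x \<in> X0 k; y \<in> X0 k; k \<in> {1, 2}\<rbrakk> \<Longrightarrow>
      F (u @ (k, x + y) # v) = F (u @ (k, x) # v) + F (u @ (k, y) # v)"
    and "\<And>u v k c x. \<lbrakk>u @ (k, x) # v \<in> words; x \<in> X0 k; k \<in> {1, 2}\<rbrakk> \<Longrightarrow>
      F (u @ (k, c *\<^sub>C x) # v) = c * F (u @ (k, x) # v)"
  shows "multilinear_form F"
  unfolding multilinear_form_def using assms letter_in_words by blast

lemma multilinear_formD:
  assumes "multilinear_form F" "u @ (k, x) # v \<in> words"
  shows "y \<in> X0 k \<Longrightarrow> F (u @ (k, x + y) # v) = F (u @ (k, x) # v) + F (u @ (k, y) # v)"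
    and "F (u @ (k, c *\<^sub>C x) # v) = c * F (u @ (k, x) # v)"
  using assms words_letter[OF assms(2)] unfolding multilinear_form_def by blast+

lemma word_tensor_linear:
  assumes "u @ (k, x) # v \<in> words"
  shows "y \<in> X0 k \<Longrightarrow>
      word_tensor (u @ (k, x + y) # v) = word_tensor (u @ (k, x) # v) + word_tensor (u @ (k, y) # v)"
    and "word_tensor (u @ (k, c *\<^sub>C x) # v) = c *\<^sub>C word_tensor (u @ (k, x) # v)"
  using multilinear_formD[OF _ assms] by (auto simp: word_tensor_def fun_eq_iff)

lemma free_space_subspace: "complex_vector.subspace free_space"
  unfolding free_space_def by (rule complex_vector.subspace_span)

lemma word_tensor_in: "u \<in> words \<Longrightarrow> word_tensor u \<in> free_space"
  by (simp add: free_space_def complex_vector.span_base)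

lemma free_space_add: "v \<in> free_space \<Longrightarrow> w \<in> free_space \<Longrightarrow> v + w \<in> free_space"
  and free_space_scale: "v \<in> free_space \<Longrightarrow> c *\<^sub>C v \<in> free_space"
  by (rule complex_vector.subspace_add[OF free_space_subspace]
      complex_vector.subspace_scale[OF free_space_subspace]; assumption)+

section \<open>The state as evaluation at a single form\<close>

definition vacuum_form :: "'v word \<Rightarrow> complex" where
  "vacuum_form u = (if u = [] then 1 else 0)"

text \<open>The multilinearity conditions mention only words with at least one letter, and there the
  form vanishes.\<close>

lemma multilinear_vacuum_form: "multilinear_form vacuum_form"
  by (rule multilinear_formI) (auto simp: vacuum_form_def)

lemma state_eq_vacuum_form:
  assumes "v \<in> free_space"
  shows "state_coord free_space0 free_vector v = v vacuum_form"
proof -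
  have sub0: "complex_vector.subspace free_space0"
    unfolding free_space0_def by (rule complex_vector.subspace_span)
  have zero: "w vacuum_form = 0" if "w \<in> free_space0" for w
    using that unfolding free_space0_def
  proof (rule complex_vector.span_induct)
    show "complex_vector.subspace {w. w vacuum_form = (0::complex)}"
      by (rule complex_vector.subspaceI) simp_all
  qed (auto simp: word_tensor_def vacuum_form_def)
  have vac: "free_vector vacuum_form = 1"
    using multilinear_vacuum_form by (simp add: free_vector_def word_tensor_def vacuum_form_def)
  \<comment> \<open>\<open>f\<close> projects onto \<open>free_space0\<close> along
    \<open>free_vector\<close>. That it lands there is preserved by linear combinations, so it is
    checked on word tensors.\<close>
  define f where "f = (\<lambda>v. v - v vacuum_form *\<^sub>C free_vector)"
  have f_add: "f (v + w) = f v + f w" for v w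
    by (simp add: f_def scaleC_add_left)
  have f_scale: "f (c *\<^sub>C v) = c *\<^sub>C f v" for c v
    by (simp add: f_def complex_vector.scale_right_diff_distrib)
  have f_0: "f 0 = 0"
    by (simp add: f_def)
  have "f v \<in> free_space0"
    using assms unfolding free_space_def
  proof (rule complex_vector.span_induct)
    show "complex_vector.subspace {v. f v \<in> free_space0}"
      using complex_vector.subspace_add[OF sub0] complex_vector.subspace_scale[OF sub0]
        complex_vector.subspace_0[OF sub0]
      by (intro complex_vector.subspaceI) (simp_all only: mem_Collect_eq f_add f_scale f_0)
  next
    fix w assume "w \<in> word_tensor ` words"
    then obtain u where u: "w = word_tensor u" "u \<in> words"
      by blast
    show "f w \<in> free_space0"
    proof (cases "u = []")
      case True
      then show ?thesis
        using u vac complex_vector.subspace_0[OF sub0] by (simp add: f_def free_vector_def)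
    next
      case False
      then have "w \<in> free_space0"
        using u by (auto simp: free_space0_def intro!: complex_vector.span_base)
      then show ?thesis
        by (simp add: f_def zero)
    qed
  qed
  then show ?thesis
    unfolding state_coord_def f_def
    \<comment> \<open>Uniqueness: a vector of \<open>free_space0\<close> vanishes at
      \<open>vacuum_form\<close>, which forces the coefficient.\<close>
    by (rule the_equality) (drule zero, simp add: vac)
qed

lemma word_tensor_vacuum_form: "word_tensor u vacuum_form = (if u = [] then 1 else 0)"
  using multilinear_vacuum_form by (simp add: word_tensor_def vacuum_form_def)

end

section \<open>Attaching a tensor factor on either side\<close>

lemma bilinear_form_flip: "bilinear_form W V (\<lambda>y x. B x y) = bilinear_form V W B"
  unfolding bilinear_form_def by blast

lemma bilinear_formD:
  assumes "bilinear_form V W B" "x \<in> V" "y \<in> W"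
  shows "x' \<in> V \<Longrightarrow> B (x + x') y = B x y + B x' y"
    and "y' \<in> W \<Longrightarrow> B x (y + y') = B x y + B x y'"
    and "B (c *\<^sub>C x) y = c * B x y" and "B x (c *\<^sub>C y) = c * B x y"
  using assms unfolding bilinear_form_def by blast+

text \<open>The common pattern of \<open>attach_left\<close> and \<open>attach_right\<close>, so
  that both sides are treated at once. \<open>U\<close> consists of the words that accept a letter
  of index \<open>k\<close> at the chosen end, and \<open>ins\<close> puts it there; every word
  either lies in \<open>U\<close> or arises from \<open>ins\<close> in a unique way.
  \<open>ins_letter\<close> separates the two places where a letter of an extended word can
  sit.\<close>

locale attachment = free_product X X0 \<xi>
  for X X0 :: "nat \<Rightarrow> 'v::complex_vector set" and \<xi> :: "nat \<Rightarrow> 'v" +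
  fixes k :: nat and U :: "'v word set" and ins :: "'v \<Rightarrow> 'v word \<Rightarrow> 'v word"
  assumes index: "k \<in> {1, 2}"
    and U_words: "u \<in> U \<Longrightarrow> u \<in> words"
    and Nil_U: "[] \<in> U"
    and U_letter: "u @ (j, x) # v \<in> words \<Longrightarrow> y \<in> X0 j \<Longrightarrow>
      u @ (j, y) # v \<in> U \<longleftrightarrow> u @ (j, x) # v \<in> U"
    and ins_words: "y \<in> X0 k \<Longrightarrow> u \<in> U \<Longrightarrow> ins y u \<in> words"
    and ins_not_U: "ins y u \<notin> U"
    and ins_inject: "ins y u = ins y' u' \<Longrightarrow> y = y' \<and> u = u'"
    and ins_hole: "\<exists>p q. \<forall>y. ins y u = p @ (k, y) # q"
    and ins_append: "\<exists>u' v'. \<forall>j x. ins y (u @ (j, x) # v) = u' @ (j, x) # v'"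
    and ins_cases: "w \<in> words \<Longrightarrow> w \<notin> U \<Longrightarrow> \<exists>y\<in>X0 k. \<exists>u\<in>U. w = ins y u"
    and ins_letter: "ins y w = u @ (j, x) # v \<Longrightarrow>
      j = k \<and> (\<forall>x'. u @ (j, x') # v = ins x' w) \<or>
      (\<exists>u' v'. \<forall>x'. u @ (j, x') # v = ins y (u' @ (j, x') # v'))"
begin

definition U_space :: "'v word_tensor set" where
  "U_space = complex_vector.span (word_tensor ` U)"

definition att :: "'v \<Rightarrow> 'v word_tensor \<Rightarrow> 'v word_tensor" where
  "att y \<eta> = (\<lambda>F. if multilinear_form F then \<eta> (\<lambda>u. if u \<in> U then F (ins y u) else 0) else 0)"

text \<open>The concatenation isomorphism of the free product: the multiple of
  \<open>\<xi> k\<close> contained in \<open>x\<close> counts as the empty tensor, the rest is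
  attached as a letter.\<close>

definition glue :: "'v \<Rightarrow> 'v word_tensor \<Rightarrow> 'v word_tensor" where
  "glue x \<eta> = coord k x *\<^sub>C \<eta> + att (centred k x) \<eta>"

lemma word_tensor_U: "u \<in> U \<Longrightarrow> word_tensor u \<in> U_space"
  by (simp add: U_space_def complex_vector.span_base)

lemma U_space_subspace: "complex_vector.subspace U_space"
  unfolding U_space_def by (rule complex_vector.subspace_span)

text \<open>The cut-off by 0 outside \<open>U\<close> is harmless because, by
  \<open>U_letter\<close>, changing a letter within its space does not affect membership in
  \<open>U\<close>.\<close>

lemma multilinear_form_ins:
  assumes "multilinear_form F" "z \<in> X0 k"
  shows "multilinear_form (\<lambda>u. if u \<in> U then F (ins z u) else 0)"
proof (rule multilinear_formI)
  fix u v j x y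
  assume *: "u @ (j, x) # v \<in> words" "x \<in> X0 j" "y \<in> X0 j" "j \<in> {1, 2}"
  have xy: "x + y \<in> X0 j"
    using complex_vector.subspace_add[OF X0_subspace[OF *(4)]] *(2,3) by blast
  obtain u' v' where eq: "\<And>x. ins z (u @ (j, x) # v) = u' @ (j, x) # v'"
    using ins_append by metis
  show "(if u @ (j, x + y) # v \<in> U then F (ins z (u @ (j, x + y) # v)) else 0) =
    (if u @ (j, x) # v \<in> U then F (ins z (u @ (j, x) # v)) else 0) +
    (if u @ (j, y) # v \<in> U then F (ins z (u @ (j, y) # v)) else 0)"
  proof (cases "u @ (j, x) # v \<in> U")
    case True
    then have "u' @ (j, x) # v' \<in> words"
      using ins_words[OF assms(2) True] eq by simp
    then show ?thesis
      using multilinear_formD(1)[OF assms(1) _ *(3)] True U_letter[OF *(1)] *(3) xy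
      by (simp add: eq)
  qed (use U_letter[OF *(1)] *(3) xy in simp)
next
  fix u v j c x
  assume *: "u @ (j, x) # v \<in> words" "x \<in> X0 j" "j \<in> {1, 2}"
  have cx: "c *\<^sub>C x \<in> X0 j"
    using complex_vector.subspace_scale[OF X0_subspace[OF *(3)]] *(2) by blast
  obtain u' v' where eq: "\<And>x. ins z (u @ (j, x) # v) = u' @ (j, x) # v'"
    using ins_append by metis
  show "(if u @ (j, c *\<^sub>C x) # v \<in> U then F (ins z (u @ (j, c *\<^sub>C x) # v)) else 0) =
    c * (if u @ (j, x) # v \<in> U then F (ins z (u @ (j, x) # v)) else 0)"
  proof (cases "u @ (j, x) # v \<in> U")
    case True
    then have "u' @ (j, x) # v' \<in> words"
      using ins_words[OF assms(2) True] eq by simp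
    then show ?thesis
      using multilinear_formD(2)[OF assms(1)] True U_letter[OF *(1)] cx by (simp add: eq)
  qed (use U_letter[OF *(1)] cx in simp)
qed

lemma att_word_tensor:
  "y \<in> X0 k \<Longrightarrow> u \<in> U \<Longrightarrow> att y (word_tensor u) = word_tensor (ins y u)"
  using multilinear_form_ins by (simp add: att_def word_tensor_def fun_eq_iff)

lemma word_tensor_ins_linear:
  assumes "u \<in> U" "x \<in> X0 k"
  shows "y \<in> X0 k \<Longrightarrow> word_tensor (ins (x + y) u) = word_tensor (ins x u) + word_tensor (ins y u)"
    and "word_tensor (ins (c *\<^sub>C x) u) = c *\<^sub>C word_tensor (ins x u)"
proof -
  obtain p q where eq: "\<And>y. ins y u = p @ (k, y) # q"
    using ins_hole by metis
  have "p @ (k, x) # q \<in> words"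
    using ins_words[OF assms(2,1)] by (simp add: eq)
  note * = word_tensor_linear[OF this]
  show "y \<in> X0 k \<Longrightarrow> word_tensor (ins (x + y) u) = word_tensor (ins x u) + word_tensor (ins y u)"
    unfolding eq by (rule *)
  show "word_tensor (ins (c *\<^sub>C x) u) = c *\<^sub>C word_tensor (ins x u)"
    unfolding eq by (rule *)
qed

lemma word_tensor_ins_zero:
  assumes "u \<in> U"
  shows "word_tensor (ins 0 u) = 0"
  using word_tensor_ins_linear(2)[OF assms complex_vector.subspace_0[OF X0_subspace[OF index]], of 0]
  by simp

lemma att_linear_right:
  "att y (\<eta> + \<eta>') = att y \<eta> + att y \<eta>'" "att y (c *\<^sub>C \<eta>) = c *\<^sub>C att y \<eta>" "att y 0 = 0"
  by (simp_all add: att_def fun_eq_iff)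

lemma att_add:
  assumes "y \<in> X0 k" "y' \<in> X0 k" "\<eta> \<in> U_space"
  shows "att (y + y') \<eta> = att y \<eta> + att y' \<eta>"
  using assms(3) unfolding U_space_def
proof (rule complex_vector.span_induct)
  show "complex_vector.subspace {\<eta>. att (y + y') \<eta> = att y \<eta> + att y' \<eta>}"
    by (rule complex_vector.subspaceI) (simp_all add: att_linear_right scaleC_add_right)
next
  fix w assume "w \<in> word_tensor ` U"
  then obtain u where "w = word_tensor u" "u \<in> U"
    by blast
  moreover have "y + y' \<in> X0 k"
    using complex_vector.subspace_add[OF X0_subspace[OF index]] assms by blast
  ultimately show "att (y + y') w = att y w + att y' w"
    using assms by (simp add: att_word_tensor word_tensor_ins_linear)
qed

lemma att_scale:
  assumes "y \<in> X0 k" "\<eta> \<in> U_space"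
  shows "att (c *\<^sub>C y) \<eta> = c *\<^sub>C att y \<eta>"
  using assms(2) unfolding U_space_def
proof (rule complex_vector.span_induct)
  show "complex_vector.subspace {\<eta>. att (c *\<^sub>C y) \<eta> = c *\<^sub>C att y \<eta>}"
    by (rule complex_vector.subspaceI)
      (simp_all add: att_linear_right scaleC_add_right scaleC_scaleC mult.commute)
next
  fix w assume "w \<in> word_tensor ` U"
  then obtain u where "w = word_tensor u" "u \<in> U"
    by blast
  moreover have "c *\<^sub>C y \<in> X0 k"
    using complex_vector.subspace_scale[OF X0_subspace[OF index]] assms by blast
  ultimately show "att (c *\<^sub>C y) w = c *\<^sub>C att y w"
    using assms by (simp add: att_word_tensor word_tensor_ins_linear)
qed

lemma glue_add:
  assumes "x \<in> X k" "x' \<in> X k" "\<eta> \<in> U_space"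
  shows "glue (x + x') \<eta> = glue x \<eta> + glue x' \<eta>"
  using coord_add[OF index assms(1,2)] centred_add[OF index assms(1,2)]
    att_add[OF centred_in[OF index assms(1)] centred_in[OF index assms(2)] assms(3)]
  by (simp add: glue_def scaleC_add_left)

lemma glue_scale:
  assumes "x \<in> X k" "\<eta> \<in> U_space"
  shows "glue (c *\<^sub>C x) \<eta> = c *\<^sub>C glue x \<eta>"
  using coord_scale[OF index assms(1)] centred_scale[OF index assms(1)]
    att_scale[OF centred_in[OF index assms(1)] assms(2)]
  by (simp add: glue_def scaleC_add_right scaleC_scaleC)

lemma glue_linear_right:
  "glue x (\<eta> + \<eta>') = glue x \<eta> + glue x \<eta>'" "glue x (c *\<^sub>C \<eta>) = c *\<^sub>C glue x \<eta>" "glue x 0 = 0"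
  by (simp_all add: glue_def att_linear_right scaleC_add_right scaleC_scaleC mult.commute)

lemma glue_bilinear: "bilinear_form (X k) U_space (\<lambda>x \<eta>. glue x \<eta> F)"
  unfolding bilinear_form_def
  by (simp add: glue_add glue_scale glue_linear_right)

lemma glue_word_tensor:
  assumes "x \<in> X k" "u \<in> U"
  shows "glue x (word_tensor u) = coord k x *\<^sub>C word_tensor u + word_tensor (ins (centred k x) u)"
  by (simp add: glue_def att_word_tensor[OF centred_in[OF index assms(1)] assms(2)])

lemma word_tensor_eq_glue: "u \<in> U \<Longrightarrow> word_tensor u = glue (\<xi> k) (word_tensor u)"
  using glue_word_tensor[OF xi_in[OF index]] coord_xi[OF index] centred_xi[OF index]
  by (simp add: word_tensor_ins_zero)

lemma word_tensor_ins_eq_glue: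
  assumes "u \<in> U" "y \<in> X0 k"
  shows "word_tensor (ins y u) = glue y (word_tensor u)"
  using glue_word_tensor[OF X0_subset_X[OF index assms(2)] assms(1)]
    coord_X0[OF index assms(2)] centred_X0[OF index assms(2)]
  by simp

text \<open>Injectivity of concatenation in dual form. A word of \<open>U\<close> is the tensor of
  \<open>\<xi> k\<close> with itself, and any other word is the tensor of its end letter with the
  rest. So \<open>B\<close> dictates the value of \<open>F\<close> at each word, and the work is to
  see that these values fit together multilinearly.\<close>

lemma glue_separating:
  assumes "bilinear_form (X k) U_space B"
  shows "\<exists>F. \<forall>x\<in>X k. \<forall>\<eta>\<in>U_space. glue x \<eta> F = B x \<eta>"
proof -
  note B = bilinear_formD[OF assms]
  \<comment> \<open>Splits a word into end letter and rest; well defined by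
    \<open>ins_inject\<close>.\<close>
  define tail where "tail w = (THE p. w = ins (fst p) (snd p))" for w
  have tail: "tail (ins y u) = (y, u)" for y u
    unfolding tail_def by (rule the_equality) (auto dest: ins_inject)
  define F where "F w = (if w \<in> U then B (\<xi> k) (word_tensor w)
    else if w \<in> words then B (fst (tail w)) (word_tensor (snd (tail w))) else 0)" for w
  have F_U: "F u = B (\<xi> k) (word_tensor u)" if "u \<in> U" for u
    using that by (simp add: F_def)
  have F_ins: "F (ins y u) = B y (word_tensor u)" if "y \<in> X0 k" "u \<in> U" for y u
    using that ins_not_U ins_words by (simp add: F_def tail)
  have key: "F (u @ (j, x + y) # v) = F (u @ (j, x) # v) + F (u @ (j, y) # v) \<and>
      F (u @ (j, c *\<^sub>C x) # v) = c * F (u @ (j, x) # v)"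
    if w: "u @ (j, x) # v \<in> words" and x: "x \<in> X0 j" and y: "y \<in> X0 j" and j: "j \<in> {1, 2}"
    for u j x v y c
  proof -
    have xy: "x + y \<in> X0 j" and cx: "c *\<^sub>C x \<in> X0 j"
      using complex_vector.subspace_add[OF X0_subspace[OF j] x y]
        complex_vector.subspace_scale[OF X0_subspace[OF j] x] by blast+
    consider "u @ (j, x) # v \<in> U" | "u @ (j, x) # v \<notin> U"
      by blast
    then show ?thesis
    proof cases
      case 1
      \<comment> \<open>The letter varies in the second argument of \<open>B\<close>, while the
        first one stays \<open>\<xi> k\<close>.\<close>
      have U: "u @ (j, z) # v \<in> U" if "z \<in> X0 j" for z
        using U_letter[OF w that] 1 by simp
      show ?thesis
        using B(2)[OF xi_in[OF index] word_tensor_U[OF U[OF x]] word_tensor_U[OF U[OF y]]]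
          B(4)[OF xi_in[OF index] word_tensor_U[OF U[OF x]]]
        by (simp add: F_U U x y xy cx word_tensor_linear[OF w])
    next
      case 2
      then obtain z s where z: "z \<in> X0 k" and s: "s \<in> U" and eq: "ins z s = u @ (j, x) # v"
        using ins_cases[OF w] by metis
      from ins_letter[OF eq] show ?thesis
      proof (elim disjE conjE exE)
        \<comment> \<open>The varying letter is the attached one, hence the first argument of
          \<open>B\<close>.\<close>
        assume jk: "j = k" and eq': "\<forall>x'. u @ (j, x') # v = ins x' s"
        have "x \<in> X k" "y \<in> X k"
          using X0_subset_X[OF index] x y jk by auto
        then show ?thesis
          using B(1)[of x "word_tensor s" y] B(3)[of x "word_tensor s"] x y xy cx s
          by (simp add: eq'[rule_format, unfolded jk] jk F_ins word_tensor_U)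
      next
        \<comment> \<open>The varying letter belongs to the rest, hence to the second argument of
          \<open>B\<close>.\<close>
        fix u' v'
        assume eq': "\<forall>x'. u @ (j, x') # v = ins z (u' @ (j, x') # v')"
        then have "s = u' @ (j, x) # v'"
          using ins_inject[of z s] eq by metis
        then have w': "u' @ (j, x) # v' \<in> U"
          using s by simp
        then have U: "u' @ (j, y) # v' \<in> U" if "y \<in> X0 j" for y
          using U_letter[OF U_words[OF w'] that] by simp
        have zX: "z \<in> X k"
          using X0_subset_X[OF index z] .
        show ?thesis
          using B(2)[OF zX word_tensor_U[OF U[OF x]] word_tensor_U[OF U[OF y]]]
            B(4)[OF zX word_tensor_U[OF U[OF x]]]
          by (simp add: eq'[rule_format] F_ins z U x y xy cx word_tensor_linear[OF U_words[OF w']])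
      qed
    qed
  qed
  have mult: "multilinear_form F"
    by (rule multilinear_formI) (use key in blast)+
  have "glue x \<eta> F = B x \<eta>" if x: "x \<in> X k" and "\<eta> \<in> U_space" for x \<eta>
  proof -
    \<comment> \<open>Membership is carried through the induction because \<open>B\<close> is linear
      only on \<open>U_space\<close>.\<close>
    have "\<eta> \<in> U_space \<and> glue x \<eta> F = B x \<eta>"
      using that(2) unfolding U_space_def
    proof (rule complex_vector.span_induct)
      have "B x 0 = 0"
        using B(4)[OF x complex_vector.subspace_0[OF U_space_subspace], of 0] by simp
      then have "complex_vector.subspace {\<eta>. \<eta> \<in> U_space \<and> glue x \<eta> F = B x \<eta>}"
        using complex_vector.subspace_0[OF U_space_subspace]
          complex_vector.subspace_add[OF U_space_subspace]
          complex_vector.subspace_scale[OF U_space_subspace]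
        by (intro complex_vector.subspaceI) (simp_all add: glue_linear_right B x)
      then show "complex_vector.subspace
          {\<eta>. \<eta> \<in> complex_vector.span (word_tensor ` U) \<and> glue x \<eta> F = B x \<eta>}"
        by (simp add: U_space_def)
    next
      fix w assume "w \<in> word_tensor ` U"
      then obtain u where w: "w = word_tensor u" and u: "u \<in> U"
        by blast
      have c: "centred k x \<in> X0 k"
        by (rule centred_in[OF index x])
      have "glue x w F = coord k x * B (\<xi> k) w + B (centred k x) w"
        using mult ins_words[OF c u] F_U[OF u] F_ins[OF c u]
        by (simp add: w glue_word_tensor[OF x u]) (simp add: word_tensor_def)
      also have "\<dots> = B (coord k x *\<^sub>C \<xi> k + centred k x) w"
        using B(1)[of "coord k x *\<^sub>C \<xi> k" w "centred k x"] B(3)[of "\<xi> k" w "coord k x"]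
          xi_in[OF index] X0_subset_X[OF index c] word_tensor_U[OF u]
          complex_vector.subspace_scale[OF X_subspace[OF index] xi_in[OF index], of "coord k x"]
        by (simp add: w)
      also have "coord k x *\<^sub>C \<xi> k + centred k x = x"
        by (simp add: centred_def)
      finally show "w \<in> complex_vector.span (word_tensor ` U) \<and> glue x w F = B x w"
        using word_tensor_U[OF u] by (simp add: w U_space_def)
    qed
    then show ?thesis ..
  qed
  then show ?thesis
    by blast
qed

lemma glue_in_free_space:
  assumes "x \<in> X k" "u \<in> U"
  shows "glue x (word_tensor u) \<in> free_space"
  using word_tensor_in[OF U_words[OF assms(2)]]
    word_tensor_in[OF ins_words[OF centred_in[OF index assms(1)] assms(2)]]
  by (simp add: glue_word_tensor[OF assms] free_space_add free_space_scale)

lemma free_space_glue: "free_space \<subseteq> complex_vector.span {glue x \<eta> |x \<eta>. x \<in> X k \<and> \<eta> \<in> U_space}"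
  unfolding free_space_def
proof (rule complex_vector.span_mono, rule subsetI)
  fix w assume "w \<in> word_tensor ` words"
  then obtain u where u: "u \<in> words" "w = word_tensor u"
    by blast
  show "w \<in> {glue x \<eta> |x \<eta>. x \<in> X k \<and> \<eta> \<in> U_space}"
  proof (cases "u \<in> U")
    case True
    then show ?thesis
      using word_tensor_eq_glue xi_in[OF index] word_tensor_U u(2) by blast
  next
    case False
    then obtain y s where "y \<in> X0 k" "s \<in> U" "u = ins y s"
      using ins_cases u(1) by blast
    then show ?thesis
      using word_tensor_ins_eq_glue X0_subset_X[OF index] word_tensor_U u(2) by blast
  qed
qed

text \<open>An induction shaped for the representations, whose action is explicit on glued
  vectors.\<close>

lemma free_space_glue_induct [consumes 1, case_names subspace glue]:
  assumes "v \<in> free_space"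
    and "complex_vector.subspace {v. P v}"
    and "\<And>x u. x \<in> X k \<Longrightarrow> u \<in> U \<Longrightarrow> P (glue x (word_tensor u))"
  shows "P v"
  using assms(1) unfolding free_space_def
proof (rule complex_vector.span_induct[OF _ assms(2)])
  fix w assume "w \<in> word_tensor ` words"
  then obtain u where u: "u \<in> words" "w = word_tensor u"
    by blast
  show "P w"
  proof (cases "u \<in> U")
    case True
    then show ?thesis
      using assms(3)[OF xi_in[OF index] True] word_tensor_eq_glue u(2) by simp
  next
    case False
    then obtain y s where s: "y \<in> X0 k" "s \<in> U" "u = ins y s"
      using ins_cases u(1) by blast
    then show ?thesis
      using assms(3)[OF X0_subset_X[OF index s(1)] s(2)] word_tensor_ins_eq_glue u(2) by simp
  qed
qed

end

lemma (in free_product) attachment_left: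
  assumes "k \<in> {1, 2}"
  shows "attachment X X0 \<xi> k (left_words k) (\<lambda>y u. (k, y) # u)"
proof (unfold_locales, goal_cases)
  case 1 then show ?case by (rule assms)
next
  case 2 then show ?case by (rule left_words_subset)
next
  case 3 then show ?case by simp
next
  case 4 then show ?case by (rule left_words_letter)
next
  case 5 then show ?case using assms by (simp add: Cons_in_words)
next
  case 6 then show ?case by (simp add: left_words_def)
next
  case 7 then show ?case by simp
next
  case 8 then show ?case by (metis append_Nil)
next
  case 9 then show ?case by (metis append_Cons)
next
  case (10 w)
  then obtain j y u where w: "w = (j, y) # u"
    by (cases w) (auto simp: left_words_def)
  then have "j = k"
    using 10 by (simp add: left_words_def)
  with 10(1) show ?case
    by (auto simp: w Cons_in_words)
next
  case (11 y w u j x v)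
  then show ?case by (cases u) auto
qed

lemma (in free_product) attachment_right:
  assumes "k \<in> {1, 2}"
  shows "attachment X X0 \<xi> k (right_words k) (\<lambda>y u. u @ [(k, y)])"
proof (unfold_locales, goal_cases)
  case 1 then show ?case by (rule assms)
next
  case 2 then show ?case by (rule right_words_subset)
next
  case 3 then show ?case by simp
next
  case 4 then show ?case by (rule right_words_letter)
next
  case 5 then show ?case using assms by (simp add: snoc_in_words)
next
  case 6 then show ?case by (simp add: right_words_def)
next
  case 7 then show ?case by simp
next
  case 8 then show ?case by blast
next
  case 9 then show ?case by (metis append_Cons append_assoc)
next
  case (10 w)
  then obtain j y u where w: "w = u @ [(j, y)]"
    by (cases w rule: rev_cases) (auto simp: right_words_def)
  then have "j = k"
    using 10 by (simp add: right_words_def)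
  with 10(1) show ?case
    by (auto simp: w snoc_in_words)
next
  case (11 y w u j x v)
  then show ?case
    by (cases v rule: rev_cases) auto
qed

section \<open>The left and right representations\<close>

text \<open>The properties shared by \<open>left_rep k\<close> and \<open>right_rep k\<close>: the
  operator acts on the tensor factor in \<open>X k\<close>. Linearity is claimed on
  \<open>free_space\<close>, where the underlying \<open>inv_into\<close> is controlled.\<close>

locale side_action = attachment X X0 \<xi> k U ins
  for X X0 :: "nat \<Rightarrow> 'v::complex_vector set" and \<xi> :: "nat \<Rightarrow> 'v"
    and k :: nat and U :: "'v word set" and ins :: "'v \<Rightarrow> 'v word \<Rightarrow> 'v word" +
  fixes rep :: "('v \<Rightarrow> 'v) \<Rightarrow> 'v word_tensor \<Rightarrow> 'v word_tensor"
  assumes rep_glue: "linear_operator_on (X k) S \<Longrightarrow> x \<in> X k \<Longrightarrow> \<eta> \<in> U_space \<Longrightarrow>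
      rep S (glue x \<eta>) = glue (S x) \<eta>"
    and rep_add: "v \<in> free_space \<Longrightarrow> w \<in> free_space \<Longrightarrow> rep S (v + w) = rep S v + rep S w"
    and rep_scale: "v \<in> free_space \<Longrightarrow> rep S (c *\<^sub>C v) = c *\<^sub>C rep S v"
begin

lemma free_space_zero: "0 \<in> free_space"
  by (rule complex_vector.subspace_0[OF free_space_subspace])

lemma rep_zero: "rep S 0 = 0"
  using rep_scale[OF free_space_zero, of S 0] by simp

lemma op_in: "linear_operator_on (X k) S \<Longrightarrow> x \<in> X k \<Longrightarrow> S x \<in> X k"
  by (simp add: linear_operator_on_def)

lemma rep_in:
  assumes "linear_operator_on (X k) S" "v \<in> free_space"
  shows "rep S v \<in> free_space"
proof -
  have "v \<in> free_space \<and> rep S v \<in> free_space"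
    using assms(2)
  proof (induction rule: free_space_glue_induct)
    case subspace
    show ?case
      by (rule complex_vector.subspaceI)
        (simp_all add: rep_zero free_space_zero rep_add rep_scale free_space_add free_space_scale)
  next
    case (glue x u)
    then show ?case
      using rep_glue[OF assms(1) glue(1) word_tensor_U[OF glue(2)]]
        glue_in_free_space[OF glue(1,2)] glue_in_free_space[OF op_in[OF assms(1) glue(1)] glue(2)]
      by simp
  qed
  then show ?thesis ..
qed

lemma linear_operator_id: "linear_operator_on (X k) (\<lambda>x. x)"
  and linear_operator_comp: "linear_operator_on (X k) S \<Longrightarrow> linear_operator_on (X k) T \<Longrightarrow>
    linear_operator_on (X k) (\<lambda>x. S (T x))"
  by (simp_all add: linear_operator_on_def)

lemma linear_operator_add:
  "linear_operator_on (X k) S \<Longrightarrow> linear_operator_on (X k) T \<Longrightarrow>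
    linear_operator_on (X k) (\<lambda>x. S x + T x)"
  using complex_vector.subspace_add[OF X_subspace[OF index]]
  by (simp add: linear_operator_on_def scaleC_add_right algebra_simps)

lemma linear_operator_scale:
  "linear_operator_on (X k) S \<Longrightarrow> linear_operator_on (X k) (\<lambda>x. c *\<^sub>C S x)"
  using complex_vector.subspace_scale[OF X_subspace[OF index]]
  by (simp add: linear_operator_on_def scaleC_add_right scaleC_scaleC mult.commute)

text \<open>This lemma and the next three make \<open>rep\<close> compatible with the unit,
  products, sums and scalars on \<open>free_space\<close>, so that a polynomial in one variable is
  represented by a single operator on \<open>X k\<close>.\<close>

lemma rep_id:
  assumes "v \<in> free_space"
  shows "rep (\<lambda>x. x) v = v"
proof -
  have "v \<in> free_space \<and> rep (\<lambda>x. x) v = v"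
    using assms
  proof (induction rule: free_space_glue_induct)
    case subspace
    show ?case
      by (rule complex_vector.subspaceI)
        (simp_all add: rep_zero free_space_zero rep_add rep_scale free_space_add free_space_scale)
  next
    case (glue x u)
    then show ?case
      using rep_glue[OF linear_operator_id glue(1) word_tensor_U[OF glue(2)]]
        glue_in_free_space[OF glue] by simp
  qed
  then show ?thesis ..
qed

lemma rep_comp:
  assumes S: "linear_operator_on (X k) S" and T: "linear_operator_on (X k) T" and v: "v \<in> free_space"
  shows "rep (\<lambda>x. S (T x)) v = rep S (rep T v)"
proof -
  have "v \<in> free_space \<and> rep (\<lambda>x. S (T x)) v = rep S (rep T v)"
    using v
  proof (induction rule: free_space_glue_induct)
    case subspace
    show ?case
      by (rule complex_vector.subspaceI)
        (simp_all add: rep_zero free_space_zero rep_add rep_scale free_space_add free_space_scale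
          rep_in[OF T])
  next
    case (glue x u)
    then show ?case
      using rep_glue[OF linear_operator_comp[OF S T] glue(1) word_tensor_U[OF glue(2)]]
        rep_glue[OF T glue(1) word_tensor_U[OF glue(2)]]
        rep_glue[OF S op_in[OF T glue(1)] word_tensor_U[OF glue(2)]]
        glue_in_free_space[OF glue] by simp
  qed
  then show ?thesis ..
qed

lemma rep_op_add:
  assumes S: "linear_operator_on (X k) S" and T: "linear_operator_on (X k) T" and v: "v \<in> free_space"
  shows "rep (\<lambda>x. S x + T x) v = rep S v + rep T v"
proof -
  have "v \<in> free_space \<and> rep (\<lambda>x. S x + T x) v = rep S v + rep T v"
    using v
  proof (induction rule: free_space_glue_induct)
    case subspace
    show ?case
      by (rule complex_vector.subspaceI)
        (simp_all add: rep_zero free_space_zero rep_add rep_scale free_space_add free_space_scale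
          fun_eq_iff algebra_simps)
  next
    case (glue x u)
    then show ?case
      using rep_glue[OF linear_operator_add[OF S T] glue(1) word_tensor_U[OF glue(2)]]
        rep_glue[OF T glue(1) word_tensor_U[OF glue(2)]]
        rep_glue[OF S glue(1) word_tensor_U[OF glue(2)]]
        glue_add[OF op_in[OF S glue(1)] op_in[OF T glue(1)] word_tensor_U[OF glue(2)]]
        glue_in_free_space[OF glue] by simp
  qed
  then show ?thesis ..
qed

lemma rep_op_scale:
  assumes S: "linear_operator_on (X k) S" and v: "v \<in> free_space"
  shows "rep (\<lambda>x. c *\<^sub>C S x) v = c *\<^sub>C rep S v"
proof -
  have "v \<in> free_space \<and> rep (\<lambda>x. c *\<^sub>C S x) v = c *\<^sub>C rep S v"
    using v
  proof (induction rule: free_space_glue_induct)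
    case subspace
    show ?case
      by (rule complex_vector.subspaceI)
        (simp_all add: rep_zero free_space_zero rep_add rep_scale free_space_add free_space_scale
          scaleC_add_right scaleC_scaleC fun_eq_iff algebra_simps)
  next
    case (glue x u)
    then show ?case
      using rep_glue[OF linear_operator_scale[OF S] glue(1) word_tensor_U[OF glue(2)]]
        rep_glue[OF S glue(1) word_tensor_U[OF glue(2)]]
        glue_scale[OF op_in[OF S glue(1)] word_tensor_U[OF glue(2)]]
        glue_in_free_space[OF glue] by simp
  qed
  then show ?thesis ..
qed

lemma rep_word_tensor:
  assumes "linear_operator_on (X k) S" "u \<in> U"
  shows "rep S (word_tensor u) =
    coord k (S (\<xi> k)) *\<^sub>C word_tensor u + word_tensor (ins (centred k (S (\<xi> k))) u)"
  using rep_glue[OF assms(1) xi_in[OF index] word_tensor_U[OF assms(2)]]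
    glue_word_tensor[OF op_in[OF assms(1) xi_in[OF index]] assms(2)] word_tensor_eq_glue[OF assms(2)]
  by simp

lemma rep_word_tensor_ins:
  assumes "linear_operator_on (X k) S" "u \<in> U" "y \<in> X0 k"
  shows "rep S (word_tensor (ins y u)) =
    coord k (S y) *\<^sub>C word_tensor u + word_tensor (ins (centred k (S y)) u)"
  using rep_glue[OF assms(1) X0_subset_X[OF index assms(3)] word_tensor_U[OF assms(2)]]
    glue_word_tensor[OF op_in[OF assms(1) X0_subset_X[OF index assms(3)]] assms(2)]
    word_tensor_ins_eq_glue[OF assms(2,3)]
  by simp

end

context free_product
begin

lemma side_action_left:
  assumes k: "k \<in> {1, 2}"
  shows "side_action X X0 \<xi> k (left_words k) (\<lambda>y u. (k, y) # u) (left_rep k)"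
proof -
  interpret attachment X X0 \<xi> k "left_words k" "\<lambda>y u. (k, y) # u"
    by (rule attachment_left[OF k])
  have space: "left_space k = U_space"
    by (simp add: left_space_def U_space_def)
  have glue: "glue = (\<lambda>x \<eta>. coord k x *\<^sub>C \<eta> + attach_left k (centred k x) \<eta>)"
    by (simp add: glue_def att_def attach_left_def fun_eq_iff)
  interpret T: tensor_iso "X k" U_space glue
    by unfold_locales (rule glue_bilinear, blast dest: glue_separating)
  have iso: "left_iso k = tensor_lift glue"
    by (simp only: left_iso_def glue)
  have rep: "left_rep k S = T.transport S id" for S
    by (simp only: left_rep_def T.transport_def iso space)
  have id: "linear_operator_on U_space id"
    by (simp add: linear_operator_on_def)
  have sub: "v \<in> T.range_space" if "v \<in> free_space" for v
    using that free_space_glue unfolding T.range_space_def by blast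
  show ?thesis
    by unfold_locales (simp_all add: rep T.transport_G[OF _ id] T.transport_add T.transport_scale sub)
qed

lemma side_action_right:
  assumes k: "k \<in> {1, 2}"
  shows "side_action X X0 \<xi> k (right_words k) (\<lambda>y u. u @ [(k, y)]) (right_rep k)"
proof -
  interpret attachment X X0 \<xi> k "right_words k" "\<lambda>y u. u @ [(k, y)]"
    by (rule attachment_right[OF k])
  have space: "right_space k = U_space"
    by (simp add: right_space_def U_space_def)
  have glue: "(\<lambda>\<eta> x. glue x \<eta>) = (\<lambda>\<eta> x. coord k x *\<^sub>C \<eta> + attach_right k (centred k x) \<eta>)"
    by (simp add: glue_def att_def attach_right_def fun_eq_iff)
  \<comment> \<open>Here \<open>X k\<close> is the right tensor factor, so \<open>glue\<close>
    enters with exchanged arguments.\<close>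
  interpret T: tensor_iso U_space "X k" "\<lambda>\<eta> x. glue x \<eta>"
  proof
    show "bilinear_form U_space (X k) (\<lambda>\<eta> x. glue x \<eta> F)" for F
      using glue_bilinear by (simp add: bilinear_form_flip[of _ _ "\<lambda>x \<eta>. glue x \<eta> F"])
  next
    fix B :: "'v word_tensor \<Rightarrow> 'v \<Rightarrow> complex"
    assume "bilinear_form U_space (X k) B"
    then have "bilinear_form (X k) U_space (\<lambda>x \<eta>. B \<eta> x)"
      by (simp add: bilinear_form_flip[of _ _ B])
    from glue_separating[OF this] show "\<exists>F. \<forall>\<eta>\<in>U_space. \<forall>x\<in>X k. glue x \<eta> F = B \<eta> x"
      by blast
  qed
  have iso: "right_iso k = tensor_lift (\<lambda>\<eta> x. glue x \<eta>)"
    by (simp only: right_iso_def glue)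
  have rep: "right_rep k S = T.transport id S" for S
    by (simp only: right_rep_def T.transport_def iso space)
  have id: "linear_operator_on U_space id"
    by (simp add: linear_operator_on_def)
  have "{glue x \<eta> |x \<eta>. x \<in> X k \<and> \<eta> \<in> U_space} = {glue x \<eta> |\<eta> x. \<eta> \<in> U_space \<and> x \<in> X k}"
    by blast
  then have sub: "v \<in> T.range_space" if "v \<in> free_space" for v
    using that free_space_glue unfolding T.range_space_def by auto
  show ?thesis
    by unfold_locales (simp_all add: rep T.transport_G[OF id] T.transport_add T.transport_scale sub)
qed

end

section \<open>Alternating moments of bi-free pairs\<close>

lemma foldr_comp_id: "foldr (\<circ>) (map f xs) id v = foldr f xs v"
  by (induction xs) simp_all

lemma foldr_operator_linear:
  fixes f :: "'i \<Rightarrow> 'w::complex_vector \<Rightarrow> 'w"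
  assumes "\<And>i v. i \<in> A \<Longrightarrow> v \<in> F \<Longrightarrow> f i v \<in> F"
    and "\<And>i v w. i \<in> A \<Longrightarrow> v \<in> F \<Longrightarrow> w \<in> F \<Longrightarrow> f i (v + w) = f i v + f i w"
    and "\<And>i c v. i \<in> A \<Longrightarrow> v \<in> F \<Longrightarrow> f i (c *\<^sub>C v) = c *\<^sub>C f i v"
    and "set ns \<subseteq> A" "v \<in> F"
  shows "foldr f ns v \<in> F"
    and "w \<in> F \<Longrightarrow> foldr f ns (v + w) = foldr f ns v + foldr f ns w"
    and "foldr f ns (c *\<^sub>C v) = c *\<^sub>C foldr f ns v"
proof -
  have mem: "foldr f ns v \<in> F" if "set ns \<subseteq> A" "v \<in> F" for ns v
    using that by (induction ns) (simp_all add: assms(1))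
  show "foldr f ns v \<in> F"
    using assms(4,5) by (rule mem)
  show "foldr f ns (v + w) = foldr f ns v + foldr f ns w" if "w \<in> F"
    using assms(4) by (induction ns) (simp_all add: assms(2) mem assms(5) that)
  show "foldr f ns (c *\<^sub>C v) = c *\<^sub>C foldr f ns v"
    using assms(4) by (induction ns) (simp_all add: assms(3) mem assms(5))
qed

section \<open>Comparing the algebra with the free product\<close>

locale bi_free_model = free_product X X0 \<xi>
  for X X0 :: "nat \<Rightarrow> 'v::complex_vector set" and \<xi> :: "nat \<Rightarrow> 'v" +
  fixes L R :: "nat \<Rightarrow> 'v \<Rightarrow> 'v"
    and \<phi> :: "'a::complex_banach_algebra_1 \<Rightarrow> complex" and a b :: "nat \<Rightarrow> 'a"
  assumes linear: "Vector_Spaces.linear scaleC scaleC \<phi>"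
    and L: "k \<in> {1, 2} \<Longrightarrow> linear_operator_on (X k) (L k)"
    and R: "k \<in> {1, 2} \<Longrightarrow> linear_operator_on (X k) (R k)"
    and moments: "set ns \<subseteq> {..<4} \<Longrightarrow>
      \<phi> (prod_list (map (nth [a 1, b 1, a 2, b 2]) ns)) =
      vector_state free_space0 free_vector
        (foldr (\<circ>) (map (nth [left_rep 1 (L 1), right_rep 1 (R 1), left_rep 2 (L 2), right_rep 2 (R 2)]) ns) id)"
begin

abbreviation vars :: "nat \<Rightarrow> 'a" where
  "vars \<equiv> nth [a 1, b 1, a 2, b 2]"

abbreviation ops :: "nat \<Rightarrow> 'v word_tensor \<Rightarrow> 'v word_tensor" where
  "ops \<equiv> nth [left_rep 1 (L 1), right_rep 1 (R 1), left_rep 2 (L 2), right_rep 2 (R 2)]"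

lemma phi_add: "\<phi> (x + y) = \<phi> x + \<phi> y"
  and phi_scale: "\<phi> (c *\<^sub>C x) = c * \<phi> x"
  using linear by (simp_all add: Vector_Spaces.linear_iff)

lemma less_4_cases: "i < (4::nat) \<Longrightarrow> i = 0 \<or> i = 1 \<or> i = 2 \<or> i = 3"
  by linarith

lemma ops_linear:
  assumes "i < 4" "v \<in> free_space"
  shows "ops i v \<in> free_space"
    and "w \<in> free_space \<Longrightarrow> ops i (v + w) = ops i v + ops i w"
    and "ops i (c *\<^sub>C v) = c *\<^sub>C ops i v"
proof -
  have one: "(1::nat) \<in> {1, 2}" and two: "(2::nat) \<in> {1, 2}"
    by simp_all
  have "\<exists>U k ins rep S. side_action X X0 \<xi> k U ins rep \<and> linear_operator_on (X k) S \<and> ops i = rep S"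
    using less_4_cases[OF assms(1)]
  proof (elim disjE)
    assume "i = 0"
    then have "ops i = left_rep 1 (L 1)" by simp
    then show ?thesis using side_action_left[OF one] L[OF one] by metis
  next
    assume "i = 1"
    then have "ops i = right_rep 1 (R 1)" by simp
    then show ?thesis using side_action_right[OF one] R[OF one] by metis
  next
    assume "i = 2"
    then have "ops i = left_rep 2 (L 2)" by simp
    then show ?thesis using side_action_left[OF two] L[OF two] by metis
  next
    assume "i = 3"
    then have "ops i = right_rep 2 (R 2)" by simp
    then show ?thesis using side_action_right[OF two] R[OF two] by metis
  qed
  then obtain U k ins rep S where *: "side_action X X0 \<xi> k U ins rep" "linear_operator_on (X k) S"
    "ops i = rep S"
    by blast
  show "ops i v \<in> free_space"
    and "w \<in> free_space \<Longrightarrow> ops i (v + w) = ops i v + ops i w"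
    and "ops i (c *\<^sub>C v) = c *\<^sub>C ops i v"
    using side_action.rep_in[OF *(1,2) assms(2)] side_action.rep_add[OF *(1) assms(2)]
      side_action.rep_scale[OF *(1) assms(2)]
    by (simp_all only: *(3))
qed

lemma foldr_ops_linear:
  assumes "set ns \<subseteq> {..<4}" "v \<in> free_space"
  shows "foldr ops ns v \<in> free_space"
    and "w \<in> free_space \<Longrightarrow> foldr ops ns (v + w) = foldr ops ns v + foldr ops ns w"
    and "foldr ops ns (c *\<^sub>C v) = c *\<^sub>C foldr ops ns v"
  by (rule foldr_operator_linear[where A = "{..<4}" and F = free_space];
      use ops_linear assms in \<open>simp only: lessThan_iff\<close>)+

text \<open>The element \<open>x\<close> of the algebra and the vector \<open>v\<close> of the free product have the same moments
  under left multiplication by the variables; this relation transfers computations with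
  polynomials in the variables to the free product.\<close>

definition agrees :: "'a \<Rightarrow> 'v word_tensor \<Rightarrow> bool" where
  "agrees x v \<longleftrightarrow> v \<in> free_space \<and>
     (\<forall>ns. set ns \<subseteq> {..<4} \<longrightarrow> \<phi> (prod_list (map vars ns) * x) = (foldr ops ns v) vacuum_form)"

lemma agrees_in: "agrees x v \<Longrightarrow> v \<in> free_space"
  by (simp add: agrees_def)

lemma agrees_phi: "agrees x v \<Longrightarrow> \<phi> x = v vacuum_form"
  unfolding agrees_def by (auto dest!: spec[of _ "[]"])

text \<open>The hypothesis on joint moments enters here: for the unit and the vacuum, the relation
  says that the two joint distributions coincide.\<close>

lemma agrees_one: "agrees 1 (word_tensor [])"
proof -
  have "\<phi> (prod_list (map vars ns) * 1) = (foldr ops ns (word_tensor [])) vacuum_form"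
    if "set ns \<subseteq> {..<4}" for ns
    using moments[OF that] foldr_ops_linear(1)[OF that, of "word_tensor []"]
      word_tensor_in[OF Nil_in_words]
    by (simp only: vector_state_def foldr_comp_id free_vector_def state_eq_vacuum_form mult_1_right
        state_eq_vacuum_form[unfolded free_vector_def])
  then show ?thesis
    by (simp add: agrees_def word_tensor_in)
qed

lemma agrees_add:
  assumes "agrees x v" "agrees y w"
  shows "agrees (x + y) (v + w)"
  using assms foldr_ops_linear(2)[of _ v w]
  by (simp add: agrees_def free_space_add distrib_left phi_add)

lemma agrees_scale:
  assumes "agrees x v"
  shows "agrees (c *\<^sub>C x) (c *\<^sub>C v)"
  using assms foldr_ops_linear(3)[of _ v c]
  by (simp add: agrees_def free_space_scale mult_scaleC_right phi_scale)

lemma agrees_var: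
  assumes "agrees x v" "i < 4"
  shows "agrees (vars i * x) (ops i v)"
proof -
  have "\<phi> (prod_list (map vars ns) * (vars i * x)) = (foldr ops ns (ops i v)) vacuum_form"
    if "set ns \<subseteq> {..<4}" for ns
  proof -
    \<comment> \<open>A variable standing left of \<open>x\<close> is absorbed as the last letter of
      the monomial, which is the operator acting first.\<close>
    have "set (ns @ [i]) \<subseteq> {..<4}"
      using that assms(2) by simp
    then have "\<phi> (prod_list (map vars (ns @ [i])) * x) = (foldr ops (ns @ [i]) v) vacuum_form"
      using assms(1) unfolding agrees_def by blast
    then show ?thesis
      by (simp only: map_append prod_list.append list.map prod_list.Cons prod_list.Nil mult_1_right
          mult.assoc foldr_append foldr_Cons foldr_Nil comp_apply id_apply)
  qed
  then show ?thesis
    using ops_linear(1)[OF assms(2) agrees_in[OF assms(1)]]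
    by (simp add: agrees_def)
qed

text \<open>Left multiplication by \<open>x\<close> is mirrored by one operator on
  \<open>X k\<close>, acting from the side that \<open>rep\<close> prescribes. Quantifying over all
  \<open>y\<close> and \<open>v\<close> makes the notion stable under products, hence suitable for
  polynomials.\<close>

definition acts :: "nat \<Rightarrow> (('v \<Rightarrow> 'v) \<Rightarrow> 'v word_tensor \<Rightarrow> 'v word_tensor) \<Rightarrow> 'a \<Rightarrow> ('v \<Rightarrow> 'v) \<Rightarrow> bool" where
  "acts k rep x S \<longleftrightarrow>
     linear_operator_on (X k) S \<and> (\<forall>y v. agrees y v \<longrightarrow> agrees (x * y) (rep S v))"

lemma acts_left: "k \<in> {1, 2} \<Longrightarrow> acts k (left_rep k) (a k) (L k)"
  and acts_right: "k \<in> {1, 2} \<Longrightarrow> acts k (right_rep k) (b k) (R k)"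
  using L R agrees_var[of _ _ 0] agrees_var[of _ _ 1] agrees_var[of _ _ 2] agrees_var[of _ _ 3]
  by (auto simp: acts_def)

lemma acts_span_powers:
  assumes "side_action X X0 \<xi> k U ins rep" "acts k rep x S"
    and "y \<in> complex_vector.span (range (\<lambda>j. x ^ j))"
  shows "\<exists>T. acts k rep y T"
proof -
  interpret side_action X X0 \<xi> k U ins rep by fact
  have add: "acts k rep (y + z) (\<lambda>v. S v + T v)" if "acts k rep y S" "acts k rep z T" for y z S T
    using that by (auto simp: acts_def linear_operator_add rep_op_add agrees_in distrib_right agrees_add)
  have scale: "acts k rep (c *\<^sub>C y) (\<lambda>v. c *\<^sub>C S v)" if "acts k rep y S" for c y S
    using that by (auto simp: acts_def linear_operator_scale rep_op_scale agrees_in mult_scaleC_left agrees_scale)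
  have one: "acts k rep 1 (\<lambda>v. v)"
    by (auto simp: acts_def linear_operator_id rep_id agrees_in)
  have power: "\<exists>T. acts k rep (x ^ j) T" for j
  proof (induction j)
    case (Suc j)
    then obtain T where "acts k rep (x ^ j) T" ..
    then have "acts k rep (x * x ^ j) (\<lambda>v. S (T v))"
      using assms(2) by (auto simp: acts_def linear_operator_comp rep_comp agrees_in mult.assoc)
    then show ?case
      by auto
  qed (use one in auto)
  from assms(3) show ?thesis
  proof (rule complex_vector.span_induct)
    show "complex_vector.subspace {y. \<exists>T. acts k rep y T}"
    proof (rule complex_vector.subspaceI)
      show "0 \<in> {y. \<exists>T. acts k rep y T}"
        using scale[OF one, of 0] by auto
    qed (use add scale in blast)+
  qed (use power in auto)
qed

text \<open>Applied to the vacuum, \<open>rep S\<close> yields \<open>coord k (S (\<xi> k))\<close>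
  times the vacuum plus the tensor of a nonempty word, on which the state vanishes.\<close>

lemma acts_coord:
  assumes "side_action X X0 \<xi> k U ins rep" "acts k rep x S"
  shows "coord k (S (\<xi> k)) = \<phi> x"
proof -
  interpret side_action X X0 \<xi> k U ins rep by fact
  have S: "linear_operator_on (X k) S" and "agrees (x * 1) (rep S (word_tensor []))"
    using assms(2) agrees_one unfolding acts_def by blast+
  moreover have "ins (centred k (S (\<xi> k))) [] \<noteq> []"
    using ins_not_U Nil_U by metis
  ultimately show ?thesis
    using agrees_phi[of "x * 1"] by (simp add: rep_word_tensor[OF S Nil_U] word_tensor_vacuum_form)
qed

end

section \<open>Orthogonality of alternating words\<close>

locale bi_free_centred = bi_free_model X X0 \<xi> L R \<phi> a b
  for X X0 :: "nat \<Rightarrow> 'v::complex_vector set" and \<xi> :: "nat \<Rightarrow> 'v" and L R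
    and \<phi> :: "'a::complex_banach_algebra_1 \<Rightarrow> complex" and a b +
  fixes \<alpha> \<beta> :: "nat \<Rightarrow> 'a" and S T :: "nat \<Rightarrow> 'v \<Rightarrow> 'v"
  assumes acts_S: "k \<in> {1, 2} \<Longrightarrow> acts k (left_rep k) (\<alpha> k) (S k)"
    and acts_T: "k \<in> {1, 2} \<Longrightarrow> acts k (right_rep k) (\<beta> k) (T k)"
    and centred_\<alpha>: "k \<in> {1, 2} \<Longrightarrow> \<phi> (\<alpha> k) = 0"
    and centred_\<beta>: "k \<in> {1, 2} \<Longrightarrow> \<phi> (\<beta> k) = 0"
begin

lemma op_S: "k \<in> {1, 2} \<Longrightarrow> linear_operator_on (X k) (S k)"
  and op_T: "k \<in> {1, 2} \<Longrightarrow> linear_operator_on (X k) (T k)"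
  using acts_S acts_T by (simp_all add: acts_def)

lemma coord_S: "k \<in> {1, 2} \<Longrightarrow> coord k (S k (\<xi> k)) = 0"
  using acts_coord[OF side_action_left acts_S] centred_\<alpha> by simp

lemma coord_T: "k \<in> {1, 2} \<Longrightarrow> coord k (T k (\<xi> k)) = 0"
  using acts_coord[OF side_action_right acts_T] centred_\<beta> by simp

lemma S_xi:
  assumes "k \<in> {1, 2}"
  shows "S k (\<xi> k) \<in> X0 k"
proof -
  have "S k (\<xi> k) \<in> X k"
    using op_S[OF assms] xi_in[OF assms] by (simp add: linear_operator_on_def)
  from centred_in[OF assms this] show ?thesis
    using coord_S[OF assms] by (simp add: centred_def)
qed

lemma T_xi:
  assumes "k \<in> {1, 2}"
  shows "T k (\<xi> k) \<in> X0 k"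
proof -
  have "T k (\<xi> k) \<in> X k"
    using op_T[OF assms] xi_in[OF assms] by (simp add: linear_operator_on_def)
  from centred_in[OF assms this] show ?thesis
    using coord_T[OF assms] by (simp add: centred_def)
qed

text \<open>Being centred removes the component of \<open>S k (\<xi> k)\<close> along
  \<open>\<xi> k\<close>, so the operator creates a letter and leaves no multiple of the old word
  behind.\<close>

lemma left_rep_word:
  assumes "k \<in> {1, 2}" "u \<in> left_words k"
  shows "left_rep k (S k) (word_tensor u) = word_tensor ((k, S k (\<xi> k)) # u)"
  using side_action.rep_word_tensor[OF side_action_left[OF assms(1)] op_S[OF assms(1)] assms(2)]
    coord_S[OF assms(1)]
  by (simp add: centred_def)

lemma right_rep_word:
  assumes "k \<in> {1, 2}" "u \<in> right_words k"
  shows "right_rep k (T k) (word_tensor u) = word_tensor (u @ [(k, T k (\<xi> k))])"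
  using side_action.rep_word_tensor[OF side_action_right[OF assms(1)] op_T[OF assms(1)] assms(2)]
    coord_T[OF assms(1)]
  by (simp add: centred_def)

lemma foldr_left_linear:
  assumes "set ns \<subseteq> {1, 2}" "v \<in> free_space"
  shows "w \<in> free_space \<Longrightarrow> foldr (\<lambda>i. left_rep i (S i)) ns (v + w) =
      foldr (\<lambda>i. left_rep i (S i)) ns v + foldr (\<lambda>i. left_rep i (S i)) ns w"
    and "foldr (\<lambda>i. left_rep i (S i)) ns (c *\<^sub>C v) = c *\<^sub>C foldr (\<lambda>i. left_rep i (S i)) ns v"
  by (rule foldr_operator_linear[where A = "{1, 2}" and F = free_space];
      (rule assms side_action.rep_in[OF side_action_left op_S] side_action.rep_add[OF side_action_left]
        side_action.rep_scale[OF side_action_left] | assumption)+)+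

lemma foldr_left_words:
  assumes "u \<in> words" "set ns \<subseteq> {1, 2}" "distinct_adj (ns @ map fst u)"
  shows "map (\<lambda>i. (i, S i (\<xi> i))) ns @ u \<in> words \<and>
    foldr (\<lambda>i. left_rep i (S i)) ns (word_tensor u) =
      word_tensor (map (\<lambda>i. (i, S i (\<xi> i))) ns @ u)"
  using assms(2,3)
proof (induction ns)
  case (Cons i ns)
  define w where "w = map (\<lambda>i. (i, S i (\<xi> i))) ns @ u"
  have i: "i \<in> {1, 2}" and IH: "w \<in> words"
    "foldr (\<lambda>i. left_rep i (S i)) ns (word_tensor u) = word_tensor w"
    using Cons by (auto simp: w_def distinct_adj_Cons)
  have "map fst w = ns @ map fst u"
    by (simp add: w_def comp_def)
  then have "w \<in> left_words i"
    using Cons.prems(2) IH(1) by (auto simp: left_words_def distinct_adj_Cons hd_map simp flip: \<open>map fst w = _\<close>)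
  then show ?case
    using left_rep_word[OF i] Cons_in_words i S_xi[OF i] IH by (simp add: w_def)
qed (use assms in simp)

definition pairing :: "nat \<Rightarrow> complex" where
  "pairing k = coord k (S k (T k (\<xi> k)))"

abbreviation T_word :: "nat list \<Rightarrow> 'v word" where
  "T_word \<equiv> map (\<lambda>k. (k, T k (\<xi> k)))"

lemma T_word_in: "set ks \<subseteq> {1, 2} \<Longrightarrow> distinct_adj ks \<Longrightarrow> T_word ks \<in> words"
  using T_xi by (auto simp: words_def comp_def)

text \<open>The last operator applied either prepends a letter, or meets the first letter of the word.
  In the first case, and for the part of the second where that letter survives, all further
  operators prepend letters, so the state vanishes.\<close>

lemma alternating_state:
  assumes "set ns \<subseteq> {1, 2}" "distinct_adj ns" "set ks \<subseteq> {1, 2}" "distinct_adj ks"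
  shows "(foldr (\<lambda>i. left_rep i (S i)) ns (word_tensor (T_word ks))) vacuum_form =
    (if rev ns = ks then prod_list (map pairing ns) else 0)"
  using assms
\<comment> \<open>The last entry of \<open>ns\<close> acts first and meets the first letter of the
  word; hence the list is taken apart from its end and compared in reverse.\<close>
proof (induction ns arbitrary: ks rule: rev_induct)
  case Nil
  then show ?case
    by (simp add: word_tensor_vacuum_form)
next
  case (snoc i ns)
  have i: "i \<in> {1, 2}" and ns: "set ns \<subseteq> {1, 2}" "distinct_adj ns"
    using snoc.prems by (auto simp: distinct_adj_append_iff)
  let ?f = "foldr (\<lambda>i. left_rep i (S i)) ns"
  \<comment> \<open>The first letter carries the index \<open>i\<close>, which differs from the last
    entry of \<open>ns\<close>, so alternation continues across the junction.\<close>
  have vanish: "?f (word_tensor ((i, y) # u)) vacuum_form = 0" if "(i, y) # u \<in> words" for y u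
  proof -
    have "distinct_adj (ns @ map fst ((i, y) # u))"
      using snoc.prems(2) that by (auto simp: words_def distinct_adj_append_iff)
    from foldr_left_words[OF that ns(1) this] show ?thesis
      by (simp add: word_tensor_vacuum_form)
  qed
  show ?case
  proof (cases "\<exists>ks'. ks = i # ks'")
    case True
    then obtain ks' where ks: "ks = i # ks'" ..
    have ks': "set ks' \<subseteq> {1, 2}" "distinct_adj ks'"
      using snoc.prems(3,4) by (auto simp: ks distinct_adj_Cons)
    have w: "T_word ks \<in> words"
      by (rule T_word_in[OF snoc.prems(3,4)])
    then have u: "T_word ks' \<in> left_words i"
      by (simp add: ks Cons_in_words)
    define y where "y = centred i (S i (T i (\<xi> i)))"
    have "S i (T i (\<xi> i)) \<in> X i"
      using op_S[OF i] X0_subset_X[OF i T_xi[OF i]] by (simp add: linear_operator_on_def)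
    then have "y \<in> X0 i"
      using centred_in[OF i] by (simp add: y_def)
    then have yw: "(i, y) # T_word ks' \<in> words"
      using i u by (simp add: Cons_in_words)
    have "left_rep i (S i) (word_tensor (T_word ks)) =
        pairing i *\<^sub>C word_tensor (T_word ks') + word_tensor ((i, y) # T_word ks')"
      using side_action.rep_word_tensor_ins[OF side_action_left[OF i] op_S[OF i] u T_xi[OF i]]
      by (simp add: ks pairing_def y_def)
    then have "foldr (\<lambda>i. left_rep i (S i)) (ns @ [i]) (word_tensor (T_word ks)) =
        pairing i *\<^sub>C ?f (word_tensor (T_word ks')) + ?f (word_tensor ((i, y) # T_word ks'))"
      using foldr_left_linear[OF ns(1)] word_tensor_in[OF yw] word_tensor_in[OF left_words_subset[OF u]]
        free_space_scale
      by simp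
    then show ?thesis
      using snoc.IH[OF ns ks'] vanish[OF yw] by (simp add: ks)
  next
    case False
    have w: "T_word ks \<in> words"
      by (rule T_word_in[OF snoc.prems(3,4)])
    then have u: "T_word ks \<in> left_words i"
      using False by (cases ks) (auto simp: left_words_def)
    then have "(i, S i (\<xi> i)) # T_word ks \<in> words"
      using i S_xi[OF i] by (simp add: Cons_in_words)
    then show ?thesis
      using vanish left_rep_word[OF i u] False by auto
  qed
qed

text \<open>The rightmost factor acts first on the vacuum and the later ones append behind it, so
  the letters appear in reverse order.\<close>

lemma agrees_right:
  assumes "set ks \<subseteq> {1, 2}" "distinct_adj ks"
  shows "agrees (prod_list (map \<beta> ks)) (word_tensor (T_word (rev ks)))"
  using assms
proof (induction ks)
  case (Cons k ks)
  have k: "k \<in> {1, 2}"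
    using Cons.prems by simp
  have IH: "agrees (prod_list (map \<beta> ks)) (word_tensor (T_word (rev ks)))"
    using Cons by (auto simp: distinct_adj_Cons)
  have "set (rev ks @ [k]) \<subseteq> {1, 2}"
    using Cons.prems(1) by auto
  moreover have "distinct_adj (rev ks @ [k])"
    using Cons.prems(2) distinct_adj_rev[of "k # ks"] by (simp only: rev.simps)
  ultimately have "T_word (rev ks @ [k]) \<in> words"
    by (rule T_word_in)
  then have "T_word (rev ks) \<in> right_words k"
    by (simp add: snoc_in_words)
  from right_rep_word[OF k this] have eq: "right_rep k (T k) (word_tensor (T_word (rev ks))) =
      word_tensor (T_word (rev (k # ks)))"
    by simp
  have "agrees (\<beta> k * prod_list (map \<beta> ks)) (right_rep k (T k) (word_tensor (T_word (rev ks))))"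
    using acts_T[OF k] IH unfolding acts_def by blast
  then show ?case
    by (simp only: eq list.map prod_list.Cons)
qed (simp add: agrees_one)

lemma agrees_left:
  assumes "set ns \<subseteq> {1, 2}" "agrees y v"
  shows "agrees (prod_list (map \<alpha> ns) * y) (foldr (\<lambda>i. left_rep i (S i)) ns v)"
  using assms
proof (induction ns)
  case (Cons i ns)
  then show ?case
    using acts_S[of i] by (simp add: acts_def mult.assoc)
qed simp

text \<open>The reversal in \<open>agrees_right\<close> cancels the one in
  \<open>alternating_state\<close>; this is why equal words pair, rather than mirrored ones.\<close>

lemma alternating_moment_pairing:
  assumes "set ns \<subseteq> {1, 2}" "distinct_adj ns" "set ks \<subseteq> {1, 2}" "distinct_adj ks"
  shows "\<phi> (prod_list (map \<alpha> ns) * prod_list (map \<beta> ks)) =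
    (if ns = ks then prod_list (map pairing ns) else 0)"
  using agrees_phi[OF agrees_left[OF assms(1) agrees_right[OF assms(3,4)]]]
    alternating_state[OF assms(1,2), of "rev ks"] assms(3,4)
  by simp

lemma pairing_eq: "k \<in> {1, 2} \<Longrightarrow> pairing k = \<phi> (\<alpha> k * \<beta> k)"
  using alternating_moment_pairing[of "[k]" "[k]"] by simp

lemma alternating_moment:
  assumes "set ns \<subseteq> {1, 2}" "distinct_adj ns" "set ks \<subseteq> {1, 2}" "distinct_adj ks"
  shows "\<phi> (prod_list (map \<alpha> ns) * prod_list (map \<beta> ks)) =
    (if ns = ks then \<Prod>i\<leftarrow>ns. \<phi> (\<alpha> i * \<beta> i) else 0)"
proof -
  have "map pairing ns = map (\<lambda>i. \<phi> (\<alpha> i * \<beta> i)) ns"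
    using assms(1) pairing_eq by (intro map_cong) auto
  then show ?thesis
    by (simp only: alternating_moment_pairing[OF assms])
qed

end

text \<open>Eliminates the operators from the hypotheses: for polynomials in one variable they exist
  by \<open>acts_span_powers\<close>.\<close>

lemma (in bi_free_model) alternating_moment_span:
  assumes "\<And>k. k \<in> {1, 2} \<Longrightarrow> \<alpha> k \<in> complex_vector.span (range (\<lambda>j. a k ^ j))"
    and "\<And>k. k \<in> {1, 2} \<Longrightarrow> \<beta> k \<in> complex_vector.span (range (\<lambda>j. b k ^ j))"
    and "\<And>k. k \<in> {1, 2} \<Longrightarrow> \<phi> (\<alpha> k) = 0" "\<And>k. k \<in> {1, 2} \<Longrightarrow> \<phi> (\<beta> k) = 0"
    and "set ns \<subseteq> {1, 2}" "distinct_adj ns" "set ks \<subseteq> {1, 2}" "distinct_adj ks"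
  shows "\<phi> (prod_list (map \<alpha> ns) * prod_list (map \<beta> ks)) =
    (if ns = ks then \<Prod>i\<leftarrow>ns. \<phi> (\<alpha> i * \<beta> i) else 0)"
proof -
  have "\<forall>k\<in>{1, 2}. \<exists>S. acts k (left_rep k) (\<alpha> k) S"
    using acts_span_powers[OF side_action_left acts_left assms(1)] by blast
  then obtain S where S: "\<And>k. k \<in> {1, 2} \<Longrightarrow> acts k (left_rep k) (\<alpha> k) (S k)"
    by metis
  have "\<forall>k\<in>{1, 2}. \<exists>T. acts k (right_rep k) (\<beta> k) T"
    using acts_span_powers[OF side_action_right acts_right assms(2)] by blast
  then obtain T where T: "\<And>k. k \<in> {1, 2} \<Longrightarrow> acts k (right_rep k) (\<beta> k) (T k)"
    by metis
  interpret bi_free_centred X X0 \<xi> L R \<phi> a b \<alpha> \<beta> S T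
    by unfold_locales (fact S T assms)+
  show ?thesis
    by (rule alternating_moment) fact+
qed

lemma bi_free_model_exists:
  fixes \<phi> :: "'a::complex_banach_algebra_1 \<Rightarrow> complex" and a b :: "nat \<Rightarrow> 'a"
  assumes "Vector_Spaces.linear scaleC scaleC \<phi>"
    and "bi_free TYPE('v::complex_vector) \<phi> (a 1, b 1) (a 2, b 2)"
  obtains X X0 \<xi> L R where "bi_free_model (X :: nat \<Rightarrow> 'v set) X0 \<xi> L R \<phi> a b"
proof -
  from assms(2) obtain X :: "nat \<Rightarrow> 'v set" and X0 \<xi> L R where
    *: "free_product X X0 \<xi>"
    "\<And>k. k \<in> {1, 2} \<Longrightarrow> linear_operator_on (X k) (L k) \<and> linear_operator_on (X k) (R k)"
    "\<And>ns. set ns \<subseteq> {..<4} \<Longrightarrow>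
       \<phi> (prod_list (map (nth [a 1, b 1, a 2, b 2]) ns)) =
       vector_state (free_product.free_space0 X0) (free_product.free_vector X0)
         (foldr (\<circ>)
           (map (nth [free_product.left_rep X X0 \<xi> 1 (L 1), free_product.right_rep X X0 \<xi> 1 (R 1),
                      free_product.left_rep X X0 \<xi> 2 (L 2), free_product.right_rep X X0 \<xi> 2 (R 2)]) ns)
           id)"
    unfolding bi_free_def fst_conv snd_conv by blast
  have "bi_free_model X X0 \<xi> L R \<phi> a b"
    unfolding bi_free_model_def bi_free_model_axioms_def using * assms(1) by blast
  then show ?thesis
    by (rule that)
qed

section \<open>Passage to norm limits\<close>

lemma tendsto_prod_list_map:
  fixes f :: "'b \<Rightarrow> nat \<Rightarrow> 'a::real_normed_algebra_1"
  assumes "\<And>k. k \<in> set ns \<Longrightarrow> f k \<longlonglongrightarrow> g k"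
  shows "(\<lambda>n. prod_list (map (\<lambda>k. f k n) ns)) \<longlonglongrightarrow> prod_list (map g ns)"
  using assms by (induction ns) (auto intro!: tendsto_mult)

text \<open>Subtracting \<open>\<phi> (f n)\<close> times the unit centres an approximating sequence
  without leaving the span, and by continuity the correction tends to 0.\<close>

lemma centred_sequence:
  fixes \<phi> :: "'a::complex_banach_algebra_1 \<Rightarrow> complex"
  assumes "Vector_Spaces.linear scaleC scaleC \<phi>" "continuous_on UNIV \<phi>" "\<phi> 1 = 1"
    and "x \<in> closure (complex_vector.span (range (\<lambda>j. a ^ j)))" "\<phi> x = 0"
  shows "\<exists>f. (\<forall>n. f n \<in> complex_vector.span (range (\<lambda>j. a ^ j)) \<and> \<phi> (f n) = 0) \<and> f \<longlonglongrightarrow> x"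
proof -
  let ?A = "complex_vector.span (range (\<lambda>j. a ^ j))"
  obtain f where f: "\<And>n. f n \<in> ?A" "f \<longlonglongrightarrow> x"
    using assms(4) unfolding closure_sequential by blast
  have lin: "\<phi> (y + z) = \<phi> y + \<phi> z" "\<phi> (c *\<^sub>C y) = c * \<phi> y" for y z c
    using assms(1) by (simp_all add: Vector_Spaces.linear_iff)
  have "1 \<in> ?A"
    by (rule complex_vector.span_base, rule image_eqI[of _ _ 0]) simp_all
  then have in_A: "f n + (- \<phi> (f n)) *\<^sub>C 1 \<in> ?A" for n
    by (intro complex_vector.span_add complex_vector.span_scale f)
  have "(\<lambda>n. \<phi> (f n)) \<longlonglongrightarrow> 0"
    using continuous_on_tendsto_compose[OF assms(2) f(2)] assms(5) by simp
  then have "(\<lambda>n. norm ((- \<phi> (f n)) *\<^sub>C (1::'a))) \<longlonglongrightarrow> 0"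
    by (simp add: norm_scaleC tendsto_norm_zero)
  then have "(\<lambda>n. f n + (- \<phi> (f n)) *\<^sub>C 1) \<longlonglongrightarrow> x + 0"
    by (intro tendsto_add f) (simp only: tendsto_norm_zero_iff)
  with in_A show ?thesis
    by (intro exI[of _ "\<lambda>n. f n + (- \<phi> (f n)) *\<^sub>C 1"]) (simp add: lin assms(3) del: complex_vector.scale_minus_left)
qed

text \<open>The identity for centred polynomials survives the limit because both sides are
  continuous in the finitely many elements involved.\<close>

lemma bi_free_alternating_moment:
  fixes \<phi> :: "'a::complex_banach_algebra_1 \<Rightarrow> complex" and a b :: "nat \<Rightarrow> 'a"
  assumes lin: "Vector_Spaces.linear scaleC scaleC \<phi>" and cont: "continuous_on UNIV \<phi>"
    and one: "\<phi> 1 = 1" and free: "bi_free TYPE('v::complex_vector) \<phi> (a 1, b 1) (a 2, b 2)"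
    and \<alpha>: "\<And>k. k \<in> {1, 2} \<Longrightarrow> \<alpha> k \<in> closure (complex_vector.span (range (\<lambda>j. a k ^ j)))"
    and \<beta>: "\<And>k. k \<in> {1, 2} \<Longrightarrow> \<beta> k \<in> closure (complex_vector.span (range (\<lambda>j. b k ^ j)))"
    and \<alpha>0: "\<And>k. k \<in> {1, 2} \<Longrightarrow> \<phi> (\<alpha> k) = 0" and \<beta>0: "\<And>k. k \<in> {1, 2} \<Longrightarrow> \<phi> (\<beta> k) = 0"
    and ns: "set ns \<subseteq> {1, 2}" "distinct_adj ns" and ks: "set ks \<subseteq> {1, 2}" "distinct_adj ks"
  shows "\<phi> (prod_list (map \<alpha> ns) * prod_list (map \<beta> ks)) =
    (if ns = ks then \<Prod>i\<leftarrow>ns. \<phi> (\<alpha> i * \<beta> i) else 0)"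
proof -
  obtain X X0 \<xi> L R where "bi_free_model (X :: nat \<Rightarrow> 'v set) X0 \<xi> L R \<phi> a b"
    using bi_free_model_exists[OF lin free] .
  then interpret bi_free_model X X0 \<xi> L R \<phi> a b .
  have "\<forall>k\<in>{1, 2}. \<exists>f. (\<forall>n. f n \<in> complex_vector.span (range (\<lambda>j. a k ^ j)) \<and> \<phi> (f n) = 0) \<and> f \<longlonglongrightarrow> \<alpha> k"
    using centred_sequence[OF lin cont one \<alpha> \<alpha>0] by blast
  from bchoice[OF this] obtain f where f: "\<And>k n. k \<in> {1, 2} \<Longrightarrow> f k n \<in> complex_vector.span (range (\<lambda>j. a k ^ j))"
    "\<And>k n. k \<in> {1, 2} \<Longrightarrow> \<phi> (f k n) = 0" "\<And>k. k \<in> {1, 2} \<Longrightarrow> f k \<longlonglongrightarrow> \<alpha> k"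
    by blast
  have "\<forall>k\<in>{1, 2}. \<exists>f. (\<forall>n. f n \<in> complex_vector.span (range (\<lambda>j. b k ^ j)) \<and> \<phi> (f n) = 0) \<and> f \<longlonglongrightarrow> \<beta> k"
    using centred_sequence[OF lin cont one \<beta> \<beta>0] by blast
  from bchoice[OF this] obtain g where g: "\<And>k n. k \<in> {1, 2} \<Longrightarrow> g k n \<in> complex_vector.span (range (\<lambda>j. b k ^ j))"
    "\<And>k n. k \<in> {1, 2} \<Longrightarrow> \<phi> (g k n) = 0" "\<And>k. k \<in> {1, 2} \<Longrightarrow> g k \<longlonglongrightarrow> \<beta> k"
    by blast
  let ?l = "\<lambda>n. \<phi> (prod_list (map (\<lambda>k. f k n) ns) * prod_list (map (\<lambda>k. g k n) ks))"
  have l: "?l \<longlonglongrightarrow> \<phi> (prod_list (map \<alpha> ns) * prod_list (map \<beta> ks))"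
    by (intro continuous_on_tendsto_compose[OF cont] tendsto_mult tendsto_prod_list_map
        f(3) g(3) subsetD[OF ns(1)] subsetD[OF ks(1)]) simp_all
  have eq: "?l = (\<lambda>n. if ns = ks then \<Prod>i\<leftarrow>ns. \<phi> (f i n * g i n) else 0)"
    by (rule ext, rule alternating_moment_span[OF f(1) g(1) f(2) g(2) ns ks])
  have "(\<lambda>n. if ns = ks then \<Prod>i\<leftarrow>ns. \<phi> (f i n * g i n) else 0) \<longlonglongrightarrow>
      (if ns = ks then \<Prod>i\<leftarrow>ns. \<phi> (\<alpha> i * \<beta> i) else 0)"
  proof (cases "ns = ks")
    case True
    have "(\<lambda>n. \<phi> (f i n * g i n)) \<longlonglongrightarrow> \<phi> (\<alpha> i * \<beta> i)" if "i \<in> set ns" for i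
      by (intro continuous_on_tendsto_compose[OF cont] tendsto_mult f(3) g(3) subsetD[OF ns(1)] that)
        simp_all
    then show ?thesis
      using tendsto_prod_list_map[of ns "\<lambda>i n. \<phi> (f i n * g i n)"] True by simp
  qed simp
  then show ?thesis
    unfolding eq[symmetric] by (rule LIMSEQ_unique[OF l])
qed

section \<open>Resolvents of a product\<close>

lemma alg_inverse_eqI:
  fixes x y :: "'a::monoid_mult"
  assumes "x * y = 1" "y * x = 1"
  shows "alg_inverse x = y"
  unfolding alg_inverse_def
proof (rule the_equality)
  fix z assume "x * z = 1 \<and> z * x = 1"
  then show "z = y"
    using assms by (metis mult.assoc mult_1_left mult_1_right)
qed (use assms in simp)

lemma neumann_series:
  fixes x :: "'a::{real_normed_algebra_1, banach}"
  assumes "norm x < 1"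
  shows "(1 - x) * (\<Sum>n. x ^ n) = 1" "(\<Sum>n. x ^ n) * (1 - x) = 1"
proof -
  have sm: "summable (\<lambda>n. x ^ n)"
    by (rule complete_algebra_summable_geometric[OF assms])
  have "x * (\<Sum>n. x ^ n) = (\<Sum>n. x ^ Suc n)" "(\<Sum>n. x ^ n) * x = (\<Sum>n. x ^ Suc n)"
    using suminf_mult[OF sm, of x] suminf_mult2[OF sm, of x] by (simp_all add: power_commutes)
  moreover have "(\<Sum>n. x ^ Suc n) = (\<Sum>n. x ^ n) - 1"
    using suminf_split_head[OF sm] by simp
  ultimately show "(1 - x) * (\<Sum>n. x ^ n) = 1" "(\<Sum>n. x ^ n) * (1 - x) = 1"
    by (simp_all add: algebra_simps)
qed

lemma alg_inverse_neumann:
  fixes x :: "'a::{real_normed_algebra_1, banach}"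
  assumes "norm x < 1"
  shows "alg_inverse (1 - x) = (\<Sum>n. x ^ n)"
    and "(1 - x) * alg_inverse (1 - x) = 1" and "alg_inverse (1 - x) * (1 - x) = 1"
  using neumann_series[OF assms] alg_inverse_eqI[OF neumann_series[OF assms]] by simp_all

lemma scaleC_power: "(c *\<^sub>C (x::'a::complex_banach_algebra_1)) ^ n = c ^ n *\<^sub>C x ^ n"
  by (induction n) (simp_all add: mult_scaleC_left mult_scaleC_right scaleC_scaleC mult.commute)

text \<open>In both identities \<open>C\<close> is a central scalar, \<open>x\<^sub>i (1 + p\<^sub>i) = C + p\<^sub>i\<close> says that \<open>1 + p\<^sub>i\<close> is
  proportional to the resolvent of \<open>x\<^sub>i\<close>, and \<open>G = (1 - p\<^sub>1 p\<^sub>2 / C)\<inverse>\<close>.\<close>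

lemma resolvent_product_right:
  fixes x1 x2 p1 p2 G C :: "'a::ring_1"
  assumes "x1 * (1 + p1) = C + p1" "x2 * (1 + p2) = C + p2"
    and "\<And>y. C * y = y * C" and "C * G = C + p1 * p2 * G"
  shows "x1 * x2 * ((1 + p2) * G * (1 + p1)) = C * ((1 + p2) * G * (1 + p1)) - C * (1 - C)"
proof -
  have "x1 * x2 * ((1 + p2) * G * (1 + p1)) = x1 * (x2 * (1 + p2)) * G * (1 + p1)"
    by (simp only: mult.assoc)
  also have "\<dots> = x1 * (C * G + p2 * G) * (1 + p1)"
    by (simp only: assms(2) mult.assoc distrib_right)
  \<comment> \<open>Replacing \<open>C * G\<close> by \<open>C + p1 * p2 * G\<close> brings the
    factor \<open>1 + p1\<close> next to \<open>x1\<close>, where the first hypothesis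
    applies.\<close>
  also have "C * G + p2 * G = C + (1 + p1) * (p2 * G)"
    by (simp add: assms(4) algebra_simps)
  also have "x1 * (C + (1 + p1) * (p2 * G)) * (1 + p1) =
      C * (x1 * (1 + p1)) + x1 * (1 + p1) * (p2 * G * (1 + p1))"
    by (simp only: distrib_left distrib_right mult.assoc assms(3)[of x1, symmetric])
      (simp only: mult.assoc[symmetric] assms(3)[of x1] add_ac)
  also have "\<dots> = C * C + C * p1 + C * p2 * G * (1 + p1) + p1 * p2 * G * (1 + p1)"
    by (simp only: assms(1)) (simp add: algebra_simps)
  finally have l: "x1 * x2 * ((1 + p2) * G * (1 + p1)) =
      C * C + C * p1 + C * p2 * G * (1 + p1) + p1 * p2 * G * (1 + p1)" .
  have "C * ((1 + p2) * G * (1 + p1)) = C * G * (1 + p1) + C * p2 * G * (1 + p1)"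
    by (simp add: algebra_simps)
  also have "\<dots> = C + C * p1 + p1 * p2 * G * (1 + p1) + C * p2 * G * (1 + p1)"
    by (simp only: assms(4)) (simp add: algebra_simps)
  finally show ?thesis
    unfolding l by (simp add: algebra_simps)
qed

lemma resolvent_product_left:
  fixes x1 x2 p1 p2 G C :: "'a::ring_1"
  assumes "(1 + p1) * x1 = C + p1" "(1 + p2) * x2 = C + p2"
    and "\<And>y. C * y = y * C" and "G * C = C + G * (p1 * p2)"
  shows "((1 + p2) * G * (1 + p1)) * (x1 * x2) = ((1 + p2) * G * (1 + p1)) * C - (1 - C) * C"
proof -
  have "((1 + p2) * G * (1 + p1)) * (x1 * x2) = (1 + p2) * (G * ((1 + p1) * x1)) * x2"
    by (simp only: mult.assoc)
  also have "G * ((1 + p1) * x1) = C + G * p1 * (1 + p2)"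
    by (simp only: assms(1) distrib_left assms(4)) (simp add: algebra_simps)
  also have "(1 + p2) * (C + G * p1 * (1 + p2)) * x2 =
      ((1 + p2) * x2) * C + (1 + p2) * G * p1 * ((1 + p2) * x2)"
    by (simp only: distrib_left distrib_right mult.assoc assms(3)[of x2])
  also have "\<dots> = C * C + p2 * C + (1 + p2) * G * p1 * C + (1 + p2) * G * p1 * p2"
    by (simp only: assms(2)) (simp add: algebra_simps)
  finally have l: "((1 + p2) * G * (1 + p1)) * (x1 * x2) =
      C * C + p2 * C + (1 + p2) * G * p1 * C + (1 + p2) * G * p1 * p2" .
  have "((1 + p2) * G * (1 + p1)) * C = (1 + p2) * (G * C) + (1 + p2) * G * (C * p1)"
    by (simp add: algebra_simps assms(3)[of p1])
  also have "\<dots> = C + p2 * C + (1 + p2) * G * p1 * p2 + (1 + p2) * G * p1 * C"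
    by (simp only: assms(4) assms(3)[of p1]) (simp add: algebra_simps)
  finally show ?thesis
    unfolding l by (simp add: algebra_simps)
qed

text \<open>The scalars \<open>u\<close> and \<open>w\<close> are independent, which keeps the
  algebra below free of \<phi>. The element is centred only when \<open>w\<close> is the value of
  \<open>psi_transform \<phi> b\<close> at \<open>u\<close>.\<close>

definition centred_resolvent :: "complex \<Rightarrow> 'a::complex_banach_algebra_1 \<Rightarrow> complex \<Rightarrow> 'a" where
  "centred_resolvent u b w = (1 / (1 + w)) *\<^sub>C alg_inverse (1 - u *\<^sub>C b) - 1"

text \<open>The source of the constant \<open>c\<close>: a resolvent \<open>r\<close> of
  \<open>x\<close> satisfies \<open>x * r = r - 1\<close>, and dividing by \<open>1 + w\<close> and
  subtracting \<open>p\<close> leaves \<open>1 - 1 / (1 + w)\<close>.\<close>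

lemma centred_resolvent_mult:
  fixes b :: "'a::complex_banach_algebra_1"
  assumes "norm (u *\<^sub>C b) < 1" "w \<noteq> -1"
  defines "p \<equiv> centred_resolvent u b w"
  shows "(u *\<^sub>C b) * (1 + p) = (w / (1 + w)) *\<^sub>C 1 + p"
    and "(1 + p) * (u *\<^sub>C b) = (w / (1 + w)) *\<^sub>C 1 + p"
proof -
  define r where "r = alg_inverse (1 - u *\<^sub>C b)"
  have "(1 - u *\<^sub>C b) * r = 1" "r * (1 - u *\<^sub>C b) = 1"
    using alg_inverse_neumann(2,3)[OF assms(1)] by (simp_all add: r_def)
  then have r: "(u *\<^sub>C b) * r = r - 1" "r * (u *\<^sub>C b) = r - 1"
    by (simp_all add: algebra_simps)
  have "1 + w \<noteq> 0"
    using assms(2) by (metis add.commute add_eq_0_iff)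
  then have c: "w / (1 + w) = 1 - 1 / (1 + w)"
    by (simp add: field_simps)
  have p: "1 + p = (1 / (1 + w)) *\<^sub>C r" "p = (1 / (1 + w)) *\<^sub>C r - 1"
    by (simp_all add: p_def centred_resolvent_def r_def)
  show "(u *\<^sub>C b) * (1 + p) = (w / (1 + w)) *\<^sub>C 1 + p" "(1 + p) * (u *\<^sub>C b) = (w / (1 + w)) *\<^sub>C 1 + p"
    unfolding p(1) c mult_scaleC_right[of "u *\<^sub>C b"] mult_scaleC_left[of _ r] r
    unfolding p(2)
    by (simp_all add: complex_vector.scale_left_diff_distrib complex_vector.scale_right_diff_distrib)
qed

definition geometric_core :: "complex \<Rightarrow> 'a::complex_banach_algebra_1 \<Rightarrow> 'a \<Rightarrow> 'a" where
  "geometric_core c p1 p2 = (1 + p2) * (\<Sum>n. ((1 / c) *\<^sub>C (p1 * p2)) ^ n) * (1 + p1)"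

lemma alg_inverse_product:
  fixes b1 b2 :: "'a::complex_banach_algebra_1"
  assumes w: "w \<noteq> -1" "w \<noteq> 0" and u: "norm (u1 *\<^sub>C b1) < 1" "norm (u2 *\<^sub>C b2) < 1"
  defines "p1 \<equiv> centred_resolvent u1 b1 w" and "p2 \<equiv> centred_resolvent u2 b2 w" and "c \<equiv> w / (1 + w)"
  assumes small: "norm (p1 * p2) < cmod c"
  shows "alg_inverse (1 - (u1 * u2 / c) *\<^sub>C (b1 * b2)) = (1 + w) *\<^sub>C geometric_core c p1 p2"
proof -
  define x1 x2 C where "x1 = u1 *\<^sub>C b1" and "x2 = u2 *\<^sub>C b2" and "C = c *\<^sub>C (1::'a)"
  define y where "y = (1 / c) *\<^sub>C (p1 * p2)"
  define G where "G = (\<Sum>n. y ^ n)"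
  define V where "V = (1 + p2) * G * (1 + p1)"
  have w1: "1 + w \<noteq> 0"
    using w(1) by (metis add.commute add_eq_0_iff)
  have c0: "c \<noteq> 0"
    using w w1 by (simp add: c_def)
  have C: "C * z = c *\<^sub>C z" "z * C = c *\<^sub>C z" for z
    by (simp_all add: C_def mult_scaleC_left mult_scaleC_right)
  have "norm y < 1"
    using small c0 by (simp add: y_def norm_scaleC norm_divide)
  then have "(1 - y) * G = 1" "G * (1 - y) = 1"
    unfolding G_def by (rule neumann_series)+
  then have "G = 1 + y * G" "G = 1 + G * y"
    by (simp_all add: algebra_simps)
  then have "c *\<^sub>C G = c *\<^sub>C (1 + y * G)" "c *\<^sub>C G = c *\<^sub>C (1 + G * y)"
    by simp_all
  then have G: "C * G = C + p1 * p2 * G" "G * C = C + G * (p1 * p2)"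
    using c0 by (simp_all add: C C_def[symmetric] scaleC_add_right y_def mult_scaleC_left
        mult_scaleC_right scaleC_scaleC)
  note right = resolvent_product_right[of x1 p1 C x2 p2 G] and left = resolvent_product_left[of p1 x1 C p2 x2 G]
  have x: "x1 * (1 + p1) = C + p1" "(1 + p1) * x1 = C + p1" "x2 * (1 + p2) = C + p2" "(1 + p2) * x2 = C + p2"
    using centred_resolvent_mult[OF u(1) w(1)] centred_resolvent_mult[OF u(2) w(1)]
    unfolding x1_def x2_def C_def p1_def p2_def c_def by simp_all
  have prod: "(u1 * u2 / c) *\<^sub>C (b1 * b2) = (1 / c) *\<^sub>C (x1 * x2)"
    by (simp add: x1_def x2_def mult_scaleC_left mult_scaleC_right scaleC_scaleC mult.commute)
  \<comment> \<open>This scalar is the defect in the two product identities; it produces the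
    normalising factor \<open>1 + w\<close>.\<close>
  have e: "1 - C = (1 / (1 + w)) *\<^sub>C 1"
  proof -
    have "(1 / (1 + w)) *\<^sub>C (1::'a) = (1 - c) *\<^sub>C 1"
      using w1 by (simp add: c_def field_simps)
    then show ?thesis
      by (simp add: C_def complex_vector.scale_left_diff_distrib)
  qed
  have "x1 * x2 * V = c *\<^sub>C (V - (1 / (1 + w)) *\<^sub>C 1)" "V * (x1 * x2) = c *\<^sub>C (V - (1 / (1 + w)) *\<^sub>C 1)"
    using right[OF x(1,3) _ G(1)] left[OF x(2,4) _ G(2)]
    unfolding V_def[symmetric] C e by (simp_all add: complex_vector.scale_right_diff_distrib)
  then have "((1 / c) *\<^sub>C (x1 * x2)) * V = V - (1 / (1 + w)) *\<^sub>C 1"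
    "V * ((1 / c) *\<^sub>C (x1 * x2)) = V - (1 / (1 + w)) *\<^sub>C 1"
    using c0 by (simp_all add: mult_scaleC_left mult_scaleC_right scaleC_scaleC)
  then have "(1 - (1 / c) *\<^sub>C (x1 * x2)) * ((1 + w) *\<^sub>C V) = 1" "((1 + w) *\<^sub>C V) * (1 - (1 / c) *\<^sub>C (x1 * x2)) = 1"
    using w1 unfolding mult_scaleC_left[of _ V] mult_scaleC_right[of _ _ V] left_diff_distrib right_diff_distrib
    by (simp_all only: mult_1_left mult_1_right) (simp_all add: complex_vector.scale_right_diff_distrib)
  then have "alg_inverse (1 - (1 / c) *\<^sub>C (x1 * x2)) = (1 + w) *\<^sub>C V"
    by (rule alg_inverse_eqI)
  then show ?thesis
    by (simp only: prod V_def G_def y_def geometric_core_def)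
qed

lemma alg_inverse_in_closure:
  fixes a :: "'a::complex_banach_algebra_1"
  assumes "norm (u *\<^sub>C a) < 1"
  shows "alg_inverse (1 - u *\<^sub>C a) \<in> closure (complex_vector.span (range (\<lambda>j. a ^ j)))"
  unfolding closure_sequential
proof (intro exI conjI allI)
  show "(\<Sum>j<n. (u *\<^sub>C a) ^ j) \<in> complex_vector.span (range (\<lambda>j. a ^ j))" for n
    unfolding scaleC_power
    by (intro complex_vector.span_sum complex_vector.span_scale complex_vector.span_base rangeI)
  show "(\<lambda>n. \<Sum>j<n. (u *\<^sub>C a) ^ j) \<longlonglongrightarrow> alg_inverse (1 - u *\<^sub>C a)"
    using summable_sums[OF complete_algebra_summable_geometric[OF assms]]
    by (simp only: alg_inverse_neumann(1)[OF assms] sums_def)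
qed

lemma centred_resolvent_in_closure:
  fixes a :: "'a::complex_banach_algebra_1"
  assumes "norm (u *\<^sub>C a) < 1"
  shows "centred_resolvent u a w \<in> closure (complex_vector.span (range (\<lambda>j. a ^ j)))"
proof -
  let ?A = "complex_vector.span (range (\<lambda>j. a ^ j))"
  obtain f where f: "\<And>n. f n \<in> ?A" "f \<longlonglongrightarrow> alg_inverse (1 - u *\<^sub>C a)"
    using alg_inverse_in_closure[OF assms] unfolding closure_sequential by blast
  have one: "1 \<in> ?A"
    by (rule complex_vector.span_base, rule image_eqI[of _ _ 0]) simp_all
  have "(\<lambda>n. ((1 / (1 + w)) *\<^sub>C 1) * f n - 1) \<longlonglongrightarrow> ((1 / (1 + w)) *\<^sub>C 1) * alg_inverse (1 - u *\<^sub>C a) - 1"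
    by (intro tendsto_intros f(2))
  then have "(\<lambda>n. (1 / (1 + w)) *\<^sub>C f n - 1) \<longlonglongrightarrow> centred_resolvent u a w"
    by (simp add: centred_resolvent_def mult_scaleC_left)
  moreover have "(1 / (1 + w)) *\<^sub>C f n - 1 \<in> ?A" for n
    by (intro complex_vector.span_diff complex_vector.span_scale one f(1))
  ultimately show ?thesis
    unfolding closure_sequential by (intro exI[of _ "\<lambda>n. (1 / (1 + w)) *\<^sub>C f n - 1"]) blast
qed

section \<open>The alternating series\<close>

text \<open>An alternating word in 1 and 2 has exactly one such form: an optional leading 2, then
  \<open>m\<close> blocks 1, 2, then an optional trailing 1. The choices of \<open>e\<close> and
  \<open>f\<close> match the four terms of
  \<open>(1 + p2) * (p1 * p2) ^ m * (1 + p1)\<close>.\<close>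

definition alternating_word :: "bool \<Rightarrow> nat \<Rightarrow> bool \<Rightarrow> nat list" where
  "alternating_word e m f =
     (if e then [2] else []) @ concat (replicate m [1, 2]) @ (if f then [1] else [])"

definition alternating_power :: "nat \<Rightarrow> 'a::ring_1 \<Rightarrow> 'a \<Rightarrow> 'a" where
  "alternating_power m p1 p2 = (1 + p2) * (p1 * p2) ^ m * (1 + p1)"

lemma set_alternating_word: "set (alternating_word e m f) \<subseteq> {1, 2}"
  by (auto simp: alternating_word_def)

lemma alternating_word_Suc: "alternating_word False (Suc m) f = 1 # 2 # alternating_word False m f"
  and alternating_word_True: "alternating_word True m f = 2 # alternating_word False m f"
  and alternating_word_0: "alternating_word False 0 f = (if f then [1] else [])"
  by (simp_all add: alternating_word_def)

lemma hd_alternating_word: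
  "alternating_word False m f = [] \<or> hd (alternating_word False m f) = 1"
  by (cases m) (simp_all add: alternating_word_Suc alternating_word_0)

lemma alternating_word_neq: "alternating_word False m f \<noteq> 2 # ns"
  using hd_alternating_word[of m f] by auto

lemma distinct_adj_alternating_word: "distinct_adj (alternating_word e m f)"
proof -
  have *: "distinct_adj (2 # alternating_word False m f)" for m
  proof (induction m)
    case (Suc m)
    then show ?case
      by (simp add: alternating_word_Suc)
  qed (simp add: alternating_word_0)
  show ?thesis
    using *[of m] by (cases e) (auto simp: alternating_word_True distinct_adj_Cons)
qed

lemma length_alternating_word: "length (alternating_word e m f) = of_bool e + 2 * m + of_bool f"
  by (simp add: alternating_word_def length_concat sum_list_replicate)

text \<open>A leading 2 decides \<open>e\<close>; then the parity of the length decides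
  \<open>f\<close>, and the length decides \<open>m\<close>.\<close>

lemma alternating_word_inject:
  "alternating_word e m f = alternating_word e' m' f' \<longleftrightarrow> e = e' \<and> m = m' \<and> f = f'"
proof
  assume eq: "alternating_word e m f = alternating_word e' m' f'"
  have "e = e'"
    using eq alternating_word_neq alternating_word_neq[symmetric]
    by (cases e; cases e') (auto simp: alternating_word_True)
  moreover from this have "2 * m + of_bool f = 2 * m' + (of_bool f' :: nat)"
    using arg_cong[OF eq, of length] by (simp add: length_alternating_word)
  then have "m = m' \<and> f = f'"
    by (cases f; cases f') (auto; presburger)+
  ultimately show "e = e' \<and> m = m' \<and> f = f'"
    by blast
qed simp

lemma prod_list_concat_replicate:
  "prod_list (map p (concat (replicate m [1, 2::nat]))) = (p 1 * p 2 :: 'a::monoid_mult) ^ m"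
  by (induction m) (simp_all add: mult.assoc)

lemma alternating_power_words:
  fixes p :: "nat \<Rightarrow> 'a::ring_1"
  shows "alternating_power m (p 1) (p 2) =
    prod_list (map p (alternating_word False m False)) + prod_list (map p (alternating_word False m True)) +
    prod_list (map p (alternating_word True m False)) + prod_list (map p (alternating_word True m True))"
  by (simp add: alternating_power_def alternating_word_def
      prod_list_concat_replicate[unfolded One_nat_def] algebra_simps)

lemma alternating_power_sums:
  fixes p1 p2 :: "'a::complex_banach_algebra_1"
  assumes "norm (p1 * p2) < cmod c"
  shows "(\<lambda>n. (1 / c) ^ n *\<^sub>C alternating_power n p1 p2) sums geometric_core c p1 p2"
proof -
  have "c \<noteq> 0"
    using assms norm_ge_zero[of "p1 * p2"] by auto
  then have "norm ((1 / c) *\<^sub>C (p1 * p2)) < 1"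
    using assms by (simp add: norm_scaleC norm_divide)
  from summable_sums[OF complete_algebra_summable_geometric[OF this]]
  have "(\<lambda>n. (1 + p2) * ((1 / c) *\<^sub>C (p1 * p2)) ^ n * (1 + p1)) sums geometric_core c p1 p2"
    unfolding geometric_core_def by (intro sums_mult sums_mult2)
  then show ?thesis
    by (simp only: scaleC_power mult_scaleC_left mult_scaleC_right alternating_power_def)
qed

section \<open>Values of a continuous functional on the series\<close>

locale continuous_functional =
  fixes \<phi> :: "'a::complex_banach_algebra_1 \<Rightarrow> complex"
  assumes linear: "Vector_Spaces.linear scaleC scaleC \<phi>"
    and continuous: "continuous_on UNIV \<phi>"
    and one: "\<phi> 1 = 1"
begin

lemma add: "\<phi> (x + y) = \<phi> x + \<phi> y"
  and scale: "\<phi> (c *\<^sub>C x) = c * \<phi> x"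
  using linear by (simp_all add: Vector_Spaces.linear_iff)

lemma zero: "\<phi> 0 = 0"
  using scale[of 0 0] by simp

lemma diff: "\<phi> (x - y) = \<phi> x - \<phi> y"
  using add[of "x - y" y] by simp

lemma sums:
  assumes "f sums s"
  shows "(\<lambda>n. \<phi> (f n)) sums \<phi> s"
proof -
  have "\<phi> (\<Sum>i<n. f i) = (\<Sum>i<n. \<phi> (f i))" for n
    by (induction n) (simp_all add: zero add)
  moreover have "(\<lambda>n. \<phi> (\<Sum>i<n. f i)) \<longlonglongrightarrow> \<phi> s"
    using assms by (intro continuous_on_tendsto_compose[OF continuous]) (simp_all add: sums_def)
  ultimately show ?thesis
    by (simp add: sums_def)
qed

text \<open>Combined with \<open>alg_inverse_product\<close>, this gives the resolvent of the
  product the state \<open>1 + w\<close>, which is what identifies the inverse function.\<close>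

lemma phi_geometric_core:
  assumes "norm (p1 * p2) < cmod c"
    and "\<And>n. \<phi> (alternating_power n p1 p2) = (if n = 0 then 1 else 0)"
  shows "\<phi> (geometric_core c p1 p2) = 1"
proof -
  have "(\<lambda>n. (1 / c) ^ n * (if n = 0 then 1 else 0)) sums \<phi> (geometric_core c p1 p2)"
    using sums[OF alternating_power_sums[OF assms(1)]] by (simp add: scale assms(2))
  moreover have "(\<lambda>n. (1 / c) ^ n * (if n = 0 then 1 else 0)) = (\<lambda>n. if n = 0 then 1 else 0)"
    by (rule ext) simp
  ultimately have "(\<lambda>n. if n = 0 then 1 else 0) sums \<phi> (geometric_core c p1 p2)"
    by simp
  then show ?thesis
    using sums_single[of 0 "\<lambda>_. 1"] by (rule sums_unique2)
qed

text \<open>Summing over \<open>m\<close> first leaves one term for each \<open>n\<close>, then a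
  geometric series in \<open>Q / (c * d)\<close>. The product form of the conclusion spares a proof
  that \<open>1 - Q / (c * d)\<close> is nonzero.\<close>

lemma phi_geometric_core_mult:
  assumes p: "norm (p1 * p2) < cmod c" and q: "norm (q1 * q2) < cmod d"
    and diag: "\<And>m n. \<phi> (alternating_power m p1 p2 * alternating_power n q1 q2) =
      (if m = n then Q ^ n * D else 0)"
  shows "\<phi> (geometric_core c p1 p2 * geometric_core d q1 q2) * (1 - Q / (c * d)) = D"
proof -
  let ?s = "\<phi> (geometric_core c p1 p2 * geometric_core d q1 q2)"
  have inner: "\<phi> (geometric_core c p1 p2 * alternating_power n q1 q2) = (1 / c) ^ n * Q ^ n * D" for n
  proof -
    have "(\<lambda>m. \<phi> ((1 / c) ^ m *\<^sub>C alternating_power m p1 p2 * alternating_power n q1 q2)) sums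
        \<phi> (geometric_core c p1 p2 * alternating_power n q1 q2)"
      by (intro sums sums_mult2 alternating_power_sums p)
    moreover have "\<phi> ((1 / c) ^ m *\<^sub>C alternating_power m p1 p2 * alternating_power n q1 q2) =
        (if m = n then (1 / c) ^ m * Q ^ m * D else 0)" for m
      by (simp add: mult_scaleC_left scale diag)
    ultimately have "(\<lambda>m. if m = n then (1 / c) ^ m * Q ^ m * D else 0) sums
        \<phi> (geometric_core c p1 p2 * alternating_power n q1 q2)"
      by simp
    then show ?thesis
      using sums_single[of n "\<lambda>m. (1 / c) ^ m * Q ^ m * D"] by (rule sums_unique2)
  qed
  have "(\<lambda>n. \<phi> (geometric_core c p1 p2 * ((1 / d) ^ n *\<^sub>C alternating_power n q1 q2))) sums ?s"
    by (intro sums sums_mult alternating_power_sums q)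
  moreover have "\<phi> (geometric_core c p1 p2 * ((1 / d) ^ n *\<^sub>C alternating_power n q1 q2)) =
      (Q / (c * d)) ^ n * D" for n
    by (simp add: mult_scaleC_right scale inner power_divide power_mult_distrib)
  ultimately have s: "(\<lambda>n. (Q / (c * d)) ^ n * D) sums ?s"
    by simp
  \<comment> \<open>Convergence is already known, so comparing the series with its own shift
    determines the sum without estimating the ratio.\<close>
  have "(\<lambda>n. (Q / (c * d)) ^ Suc n * D) sums (Q / (c * d) * ?s)"
    using sums_mult[OF s, of "Q / (c * d)"] by (simp add: mult_ac)
  then have "(\<lambda>n. (Q / (c * d)) ^ n * D) sums (Q / (c * d) * ?s + D)"
    by (subst (asm) sums_Suc_iff) simp
  with s have "?s = Q / (c * d) * ?s + D"
    by (rule sums_unique2)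
  then show ?thesis
    by (simp add: algebra_simps)
qed

text \<open>Of the sixteen products of words only the four with equal words survive. Apart from the
  common power their values are \<open>1\<close>, \<open>Q 1\<close>, \<open>Q 2\<close> and
  \<open>Q 1 * Q 2\<close>, which add up to \<open>(1 + Q 1) * (1 + Q 2)\<close>.\<close>

lemma alternating_diagonal:
  fixes p q :: "nat \<Rightarrow> 'a"
  assumes alt: "\<And>ns ks. \<lbrakk>set ns \<subseteq> {1, 2}; distinct_adj ns; set ks \<subseteq> {1, 2}; distinct_adj ks\<rbrakk> \<Longrightarrow>
      \<phi> (prod_list (map p ns) * prod_list (map q ks)) =
      (if ns = ks then \<Prod>i\<leftarrow>ns. \<phi> (p i * q i) else 0)"
  defines "Q \<equiv> \<lambda>i. \<phi> (p i * q i)"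
  shows "\<phi> (alternating_power m (p 1) (p 2) * alternating_power n (q 1) (q 2)) =
      (if m = n then (Q 1 * Q 2) ^ n * ((1 + Q 1) * (1 + Q 2)) else 0)"
    and "\<phi> (alternating_power n (p 1) (p 2)) = (if n = 0 then 1 else 0)"
    and "\<phi> (alternating_power n (q 1) (q 2)) = (if n = 0 then 1 else 0)"
proof -
  have word: "\<phi> (prod_list (map p (alternating_word e m f)) * prod_list (map q (alternating_word e' n f'))) =
      (if e = e' \<and> m = n \<and> f = f' then
        (if e then Q 2 else 1) * (Q 1 * Q 2) ^ n * (if f then Q 1 else 1) else 0)" for e f e' f' m n
  proof -
    have "(\<Prod>i\<leftarrow>alternating_word e n f. \<phi> (p i * q i)) =
        (if e then Q 2 else 1) * (Q 1 * Q 2) ^ n * (if f then Q 1 else 1)"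
      unfolding Q_def[symmetric]
      by (simp add: alternating_word_def prod_list_concat_replicate[unfolded One_nat_def] mult.assoc)
    then show ?thesis
      using alt[OF set_alternating_word distinct_adj_alternating_word
          set_alternating_word distinct_adj_alternating_word, of e m f e' n f']
      by (auto simp: alternating_word_inject)
  qed
  show "\<phi> (alternating_power m (p 1) (p 2) * alternating_power n (q 1) (q 2)) =
      (if m = n then (Q 1 * Q 2) ^ n * ((1 + Q 1) * (1 + Q 2)) else 0)"
    unfolding alternating_power_words[of m p] alternating_power_words[of n q] distrib_left distrib_right add word
    by (simp add: algebra_simps)
  have left: "\<phi> (prod_list (map p (alternating_word e n f))) = (if alternating_word e n f = [] then 1 else 0)" for e f n
    using alt[OF set_alternating_word distinct_adj_alternating_word, of "[]" e n f] by simp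
  have right: "\<phi> (prod_list (map q (alternating_word e n f))) = (if alternating_word e n f = [] then 1 else 0)" for e f n
    using alt[OF _ _ set_alternating_word distinct_adj_alternating_word, of "[]" e n f] by simp
  have empty: "alternating_word e n f = [] \<longleftrightarrow> \<not> e \<and> n = 0 \<and> \<not> f" for e n f
    using alternating_word_inject[of e n f False 0 False] by (simp add: alternating_word_0)
  show "\<phi> (alternating_power n (p 1) (p 2)) = (if n = 0 then 1 else 0)"
    unfolding alternating_power_words[of n p] add left empty by simp
  show "\<phi> (alternating_power n (q 1) (q 2)) = (if n = 0 then 1 else 0)"
    unfolding alternating_power_words[of n q] add right empty by simp
qed

end

section \<open>The inverse function of \<open>\<psi>\<close>\<close>

lemma local_inverse_exists:
  assumes holf: "f holomorphic_on S" and S: "open S" "0 \<in> S" and "f 0 = 0" "deriv f 0 \<noteq> 0"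
  shows "\<exists>g. local_inverse_at_0 f g"
proof -
  obtain r where r: "r > 0" "ball 0 r \<subseteq> S" "open (f ` ball 0 r)" "inj_on f (ball 0 r)"
    using has_complex_derivative_locally_invertible[OF holf S(2,1) assms(5)] .
  have "f holomorphic_on ball 0 r"
    using holf r(2) by (rule holomorphic_on_subset)
  then obtain g where g: "g holomorphic_on f ` ball 0 r" "\<And>z. z \<in> ball 0 r \<Longrightarrow> g (f z) = z"
    using holomorphic_has_inverse[OF _ open_ball r(4)] by metis
  have 0: "0 \<in> f ` ball 0 r"
    using r(1) assms(4) by (intro image_eqI[of _ _ 0]) simp_all
  have "g analytic_on {0}"
    using g(1) r(3) 0 by (meson analytic_at)
  moreover have "g 0 = 0"
    using g(2)[of 0] r(1) assms(4) by simp
  moreover have "\<forall>\<^sub>F z in nhds 0. f (g z) = z"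
    using eventually_nhds_in_open[OF r(3) 0] by eventually_elim (auto simp: g(2))
  moreover have "\<forall>\<^sub>F t in nhds 0. g (f t) = t"
    using eventually_nhds_in_open[OF open_ball, of 0 0 r] r(1)
    by (auto elim!: eventually_mono simp: g(2))
  ultimately show ?thesis
    unfolding local_inverse_at_0_def by blast
qed

context continuous_functional
begin

lemma h_transform_sums:
  assumes "norm (t *\<^sub>C a) < 1"
  shows "(\<lambda>n. \<phi> (a ^ n) * t ^ n) sums h_transform \<phi> a t"
  using sums[OF summable_sums[OF complete_algebra_summable_geometric[OF assms]]]
  by (simp add: h_transform_def alg_inverse_neumann(1)[OF assms] scaleC_power scale mult.commute)

lemma psi_transform_0: "psi_transform \<phi> a 0 = 0"
proof -
  have "alg_inverse (1 - 0 *\<^sub>C a) = 1"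
    by (rule alg_inverse_eqI) simp_all
  then show ?thesis
    by (simp add: psi_transform_def h_transform_def one)
qed

lemma chi_transform_local_inverse:
  assumes "\<phi> a \<noteq> 0"
  shows "local_inverse_at_0 (psi_transform \<phi> a) (chi_transform \<phi> a)"
proof -
  \<comment> \<open>Chosen so that \<open>norm (t *\<^sub>C a) < 1\<close> on the ball, where the
    Neumann series turns \<open>psi_transform\<close> into a power series with linear coefficient
    \<open>\<phi> a\<close>.\<close>
  define r where "r = 1 / (norm a + 1)"
  have r: "r > 0" "r * norm a < 1"
    by (simp_all add: r_def add_nonneg_pos)
  have small: "norm (t *\<^sub>C a) < 1" if "t \<in> ball 0 r" for t
  proof -
    have "norm (t *\<^sub>C a) \<le> r * norm a"
      using that by (simp add: norm_scaleC mult_right_mono)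
    then show ?thesis
      using r(2) by linarith
  qed
  have h: "(\<lambda>n. \<phi> (a ^ n) * (t - 0) ^ n) sums h_transform \<phi> a t" if "t \<in> ball 0 r" for t
    using h_transform_sums[OF small[OF that]] by simp
  have "h_transform \<phi> a holomorphic_on ball 0 r"
    by (rule power_series_holomorphic[OF h])
  then have hol: "psi_transform \<phi> a holomorphic_on ball 0 r"
    unfolding psi_transform_def by (intro holomorphic_intros)
  \<comment> \<open>A nonzero point of convergence, which allows termwise differentiation at
    0.\<close>
  have "complex_of_real (r / 2) \<in> ball 0 r"
    using r(1) by simp
  then have sm: "summable (\<lambda>n. \<phi> (a ^ n) * complex_of_real (r / 2) ^ n)"
    using sums_summable[OF h] by simp
  have "((\<lambda>t. \<Sum>n. \<phi> (a ^ n) * t ^ n) has_field_derivative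
      (\<Sum>n. diffs (\<lambda>n. \<phi> (a ^ n)) n * 0 ^ n)) (at 0)"
    by (rule termdiffs_strong[OF sm]) (use r(1) in simp)
  moreover have "(\<Sum>n. diffs (\<lambda>n. \<phi> (a ^ n)) n * 0 ^ n) = \<phi> a"
    by (simp add: diffs_def)
  ultimately have deriv: "((\<lambda>t. (\<Sum>n. \<phi> (a ^ n) * t ^ n) - 1) has_field_derivative \<phi> a - 0) (at 0)"
    by (intro DERIV_diff DERIV_const) simp
  have ev: "\<forall>\<^sub>F t in nhds 0. (\<Sum>n. \<phi> (a ^ n) * t ^ n) - 1 = psi_transform \<phi> a t"
  proof (rule eventually_mono[OF eventually_nhds_in_open[OF open_ball, of 0 0 r]])
    show "0 \<in> ball 0 r"
      using r(1) by simp
  next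
    fix t :: complex assume "t \<in> ball 0 r"
    from sums_unique[OF h[OF this]] show "(\<Sum>n. \<phi> (a ^ n) * t ^ n) - 1 = psi_transform \<phi> a t"
      by (simp add: psi_transform_def)
  qed
  have "(psi_transform \<phi> a has_field_derivative \<phi> a) (at 0)"
    using deriv DERIV_cong_ev[OF refl ev refl] by simp
  then have "deriv (psi_transform \<phi> a) 0 \<noteq> 0"
    using assms by (simp add: DERIV_imp_deriv)
  then have "\<exists>g. local_inverse_at_0 (psi_transform \<phi> a) g"
    using local_inverse_exists[OF hol _ _ psi_transform_0] r(1) by simp
  then show ?thesis
    unfolding chi_transform_def by (rule someI_ex)
qed

section \<open>Estimates near the origin\<close>

text \<open>The difference quotient at 0 converges, hence is bounded near 0.\<close>

lemma chi_transform_small: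
  assumes "\<phi> a \<noteq> 0"
  obtains K where "K > 0" "\<forall>\<^sub>F z in nhds 0. cmod (chi_transform \<phi> a z) \<le> K * cmod z"
proof -
  have g: "chi_transform \<phi> a analytic_on {0}" "chi_transform \<phi> a 0 = 0"
    using chi_transform_local_inverse[OF assms] by (simp_all add: local_inverse_at_0_def)
  obtain D where "(chi_transform \<phi> a has_field_derivative D) (at 0)"
    using analytic_on_imp_differentiable_at[OF g(1)] field_differentiable_def by auto
  then have "((\<lambda>z. chi_transform \<phi> a z / z) \<longlongrightarrow> D) (at 0)"
    by (simp add: has_field_derivative_iff g(2))
  then have "((\<lambda>z. cmod (chi_transform \<phi> a z / z)) \<longlongrightarrow> cmod D) (at 0)"
    by (rule tendsto_norm)
  then have "\<forall>\<^sub>F z in at 0. cmod (chi_transform \<phi> a z / z) < cmod D + 1"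
    by (rule order_tendstoD) simp
  then have "\<forall>\<^sub>F z in nhds 0. cmod (chi_transform \<phi> a z) \<le> (cmod D + 1) * cmod z"
    unfolding eventually_at_filter
  proof eventually_elim
    case (elim z)
    then show ?case
      by (cases "z = 0") (auto simp: g(2) norm_divide divide_simps)
  qed
  then show ?thesis
    by (rule that[rotated]) (simp add: add_nonneg_pos)
qed

lemma eventually_norm_less:
  assumes "0 < e"
  shows "\<forall>\<^sub>F z::complex in nhds 0. cmod z < e"
  using assms by (auto simp: eventually_nhds_metric dist_norm)

lemma eventually_linear_bound_less:
  assumes "\<forall>\<^sub>F z::complex in nhds 0. f z \<le> K * cmod z" "0 < K" "0 < e"
  shows "\<forall>\<^sub>F z in nhds 0. f z < e"
proof -
  have "\<forall>\<^sub>F z::complex in nhds 0. cmod z < e / K"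
    using assms by (intro eventually_norm_less) simp
  with assms(1) show ?thesis
  proof eventually_elim
    case (elim z)
    then have "K * cmod z < e"
      using assms(2) by (simp add: pos_less_divide_eq mult.commute)
    with elim show ?case
      by linarith
  qed
qed

abbreviation resolvent_at_chi :: "'a \<Rightarrow> complex \<Rightarrow> 'a" where
  "resolvent_at_chi a z \<equiv> centred_resolvent (chi_transform \<phi> a z) a z"

text \<open>From \<open>r - 1 = x * r\<close> the norm of \<open>r\<close> is at most
  \<open>1 + norm r / 2\<close>, hence at most 2.\<close>

lemma norm_neumann_minus_one:
  assumes "norm (x :: 'a) \<le> 1 / 2"
  shows "norm (alg_inverse (1 - x) - 1) \<le> 2 * norm x"
proof -
  define r where "r = alg_inverse (1 - x)"
  have "(1 - x) * r = 1"
    using alg_inverse_neumann(2)[of x] assms by (simp add: r_def)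
  then have r: "r - 1 = x * r"
    by (simp add: algebra_simps)
  then have "norm (r - 1) \<le> norm x * norm r"
    by (simp add: norm_mult_ineq)
  moreover have "norm r \<le> norm (r - 1) + 1"
    using norm_triangle_ineq[of "r - 1" 1] by simp
  moreover have "norm x * norm r \<le> 1 / 2 * norm r"
    using assms by (rule mult_right_mono) simp
  ultimately have "norm r \<le> 2"
    by linarith
  then have "norm x * norm r \<le> norm x * 2"
    by (rule mult_left_mono) simp
  with \<open>norm (r - 1) \<le> norm x * norm r\<close> show ?thesis
    by (simp add: r_def mult.commute)
qed

lemma resolvent_at_chi_small:
  assumes "\<phi> a \<noteq> 0"
  obtains K where "K > 0" "\<forall>\<^sub>F z in nhds 0. cmod (chi_transform \<phi> a z) \<le> K * cmod z"
    "\<forall>\<^sub>F z in nhds 0. norm (chi_transform \<phi> a z *\<^sub>C a) < 1"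
    "\<forall>\<^sub>F z in nhds 0. norm (resolvent_at_chi a z) \<le> K * cmod z"
proof -
  obtain K where K: "K > 0" "\<forall>\<^sub>F z in nhds 0. cmod (chi_transform \<phi> a z) \<le> K * cmod z"
    using chi_transform_small[OF assms] .
  \<comment> \<open>The factor \<open>1 / (1 + z)\<close> costs 2 and
    \<open>norm_neumann_minus_one\<close> costs another 2, which gives
    \<open>2 * (2 * K * norm a + 1)\<close>; the summand 1 comes from the centring term
    \<open>z\<close>.\<close>
  define M where "M = 4 * K * norm a + 2"
  have M: "M > 0"
    using K(1) by (simp add: M_def add_nonneg_pos)
  \<comment> \<open>The added 1 keeps the constant positive, as
    \<open>eventually_linear_bound_less\<close> demands.\<close>
  have ev: "\<forall>\<^sub>F z in nhds 0. norm (chi_transform \<phi> a z *\<^sub>C a) \<le> (K * norm a + 1) * cmod z"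
    using K(2)
  proof eventually_elim
    case (elim z)
    have "norm (chi_transform \<phi> a z *\<^sub>C a) \<le> K * cmod z * norm a"
      using mult_right_mono[OF elim norm_ge_zero[of a]] by (simp add: norm_scaleC)
    moreover have "(K * norm a + 1) * cmod z = K * cmod z * norm a + cmod z"
      by (simp add: algebra_simps)
    ultimately show ?case
      using norm_ge_zero[of z] by linarith
  qed
  have half: "\<forall>\<^sub>F z in nhds 0. norm (chi_transform \<phi> a z *\<^sub>C a) < 1 / 2"
    by (rule eventually_linear_bound_less[OF ev]) (use K(1) in \<open>simp_all add: add_nonneg_pos\<close>)
  have res: "\<forall>\<^sub>F z in nhds 0. norm (resolvent_at_chi a z) \<le> M * cmod z"
    using K(2) half eventually_norm_less[of "1 / 2", simplified]
  proof eventually_elim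
    case (elim z)
    define x where "x = chi_transform \<phi> a z *\<^sub>C a"
    have z1: "1 / 2 \<le> cmod (1 + z)"
      using norm_triangle_ineq2[of 1 "- z"] elim(3) by simp
    then have z0: "1 + z \<noteq> 0"
      by auto
    have "resolvent_at_chi a z = (1 / (1 + z)) *\<^sub>C (alg_inverse (1 - x) - 1 - z *\<^sub>C 1)"
    proof -
      have "(1 / (1 + z)) *\<^sub>C ((1 + z) *\<^sub>C (1::'a)) = 1"
        using z0 by simp
      then have "(1 / (1 + z)) *\<^sub>C (1 + z *\<^sub>C (1::'a)) = 1"
        by (simp only: complex_vector.scale_left_distrib complex_vector.scale_one)
      then show ?thesis
        by (simp add: centred_resolvent_def x_def complex_vector.scale_right_diff_distrib
            scaleC_add_right algebra_simps)
    qed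
    then have "norm (resolvent_at_chi a z) = norm (alg_inverse (1 - x) - 1 - z *\<^sub>C 1) / cmod (1 + z)"
      by (simp add: norm_scaleC norm_divide)
    also have "\<dots> \<le> norm (alg_inverse (1 - x) - 1 - z *\<^sub>C 1) / (1 / 2)"
      using z1 by (intro divide_left_mono) auto
    also have "\<dots> = 2 * norm (alg_inverse (1 - x) - 1 - z *\<^sub>C 1)"
      by simp
    also have "norm (alg_inverse (1 - x) - 1 - z *\<^sub>C 1) \<le> norm (alg_inverse (1 - x) - 1) + cmod z"
      using norm_triangle_ineq4[of "alg_inverse (1 - x) - 1" "z *\<^sub>C 1"] by (simp add: norm_scaleC)
    also have "norm (alg_inverse (1 - x) - 1) \<le> 2 * norm x"
      using elim(2) by (intro norm_neumann_minus_one) (simp add: x_def)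
    also have "norm x \<le> K * cmod z * norm a"
      using mult_right_mono[OF elim(1) norm_ge_zero[of a]] by (simp add: norm_scaleC x_def)
    finally show ?case
      by (simp add: M_def algebra_simps)
  qed
  have mono: "K * cmod z \<le> max K M * cmod z" "M * cmod z \<le> max K M * cmod z" for z
    by (simp_all add: mult_right_mono)
  show ?thesis
  proof (rule that[of "max K M"])
    show "0 < max K M"
      using K(1) by simp
    show "\<forall>\<^sub>F z in nhds 0. cmod (chi_transform \<phi> a z) \<le> max K M * cmod z"
      by (rule eventually_mono[OF K(2)]) (use mono in \<open>blast intro: order_trans\<close>)
    show "\<forall>\<^sub>F z in nhds 0. norm (chi_transform \<phi> a z *\<^sub>C a) < 1"
      by (rule eventually_mono[OF half]) simp
    show "\<forall>\<^sub>F z in nhds 0. norm (resolvent_at_chi a z) \<le> max K M * cmod z"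
      by (rule eventually_mono[OF res]) (use mono in \<open>blast intro: order_trans\<close>)
  qed
qed

lemma phi_resolvent_at_chi:
  assumes "\<phi> a \<noteq> 0"
  shows "\<forall>\<^sub>F z in nhds 0. \<phi> (resolvent_at_chi a z) = 0"
proof -
  have "\<forall>\<^sub>F z in nhds 0. psi_transform \<phi> a (chi_transform \<phi> a z) = z"
    using chi_transform_local_inverse[OF assms] by (simp add: local_inverse_at_0_def)
  moreover have "\<forall>\<^sub>F z::complex in nhds 0. cmod z < 1"
    by (rule eventually_norm_less) simp
  ultimately show ?thesis
  proof eventually_elim
    case (elim z)
    then have "\<phi> (alg_inverse (1 - chi_transform \<phi> a z *\<^sub>C a)) = 1 + z"
      by (simp add: psi_transform_def h_transform_def algebra_simps)
    moreover have "1 + z \<noteq> 0"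
    proof
      assume "1 + z = 0"
      then have "z = -1"
        by (simp add: add_eq_0_iff)
      with elim(2) show False
        by simp
    qed
    ultimately show ?case
      by (simp add: centred_resolvent_def diff scale one)
  qed
qed

lemma alg_inverse_chi_product:
  assumes x: "\<phi> x1 \<noteq> 0" "\<phi> x2 \<noteq> 0" "\<phi> (x1 * x2) \<noteq> 0"
    and free: "\<And>p1 p2 n. \<lbrakk>p1 \<in> closure (complex_vector.span (range (\<lambda>j. x1 ^ j)));
        p2 \<in> closure (complex_vector.span (range (\<lambda>j. x2 ^ j))); \<phi> p1 = 0; \<phi> p2 = 0\<rbrakk> \<Longrightarrow>
      \<phi> (alternating_power n p1 p2) = (if n = 0 then 1 else 0)"
  shows "\<forall>\<^sub>F z in nhds 0. z \<noteq> 0 \<longrightarrow>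
    norm (resolvent_at_chi x1 z * resolvent_at_chi x2 z) < cmod (z / (1 + z)) \<and>
    alg_inverse (1 - chi_transform \<phi> (x1 * x2) z *\<^sub>C (x1 * x2)) =
      (1 + z) *\<^sub>C geometric_core (z / (1 + z)) (resolvent_at_chi x1 z) (resolvent_at_chi x2 z)"
proof -
  obtain K1 where K1: "K1 > 0" "\<forall>\<^sub>F z in nhds 0. cmod (chi_transform \<phi> x1 z) \<le> K1 * cmod z"
    "\<forall>\<^sub>F z in nhds 0. norm (chi_transform \<phi> x1 z *\<^sub>C x1) < 1"
    "\<forall>\<^sub>F z in nhds 0. norm (resolvent_at_chi x1 z) \<le> K1 * cmod z"
    using resolvent_at_chi_small[OF x(1)] .
  obtain K2 where K2: "K2 > 0" "\<forall>\<^sub>F z in nhds 0. cmod (chi_transform \<phi> x2 z) \<le> K2 * cmod z"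
    "\<forall>\<^sub>F z in nhds 0. norm (chi_transform \<phi> x2 z *\<^sub>C x2) < 1"
    "\<forall>\<^sub>F z in nhds 0. norm (resolvent_at_chi x2 z) \<le> K2 * cmod z"
    using resolvent_at_chi_small[OF x(2)] .
  have "\<forall>\<^sub>F t in nhds 0. chi_transform \<phi> (x1 * x2) (psi_transform \<phi> (x1 * x2) t) = t"
    using chi_transform_local_inverse[OF x(3)] by (simp add: local_inverse_at_0_def)
  then obtain \<delta> where \<delta>: "\<delta> > 0"
    "\<And>t. cmod t < \<delta> \<Longrightarrow> chi_transform \<phi> (x1 * x2) (psi_transform \<phi> (x1 * x2) t) = t"
    unfolding eventually_nhds_metric dist_norm by auto
  \<comment> \<open>Since \<open>cmod c\<close> exceeds \<open>cmod z / 2\<close>, both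
    \<open>norm (p1 * p2) / cmod c\<close> and \<open>cmod t\<close> are at most
    \<open>M * cmod z\<close>. The first has to stay below 1, the second below \<delta>.\<close>
  define M where "M = 2 * K1 * K2"
  have M: "M > 0"
    using K1(1) K2(1) by (simp add: M_def)
  have "\<forall>\<^sub>F z::complex in nhds 0. cmod z < min (1 / 2) (min (1 / M) (\<delta> / M))"
    using M \<delta>(1) by (intro eventually_norm_less) simp
  with K1(2-4) K2(2-4) phi_resolvent_at_chi[OF x(1)] phi_resolvent_at_chi[OF x(2)]
  show ?thesis
  proof eventually_elim
    case (elim z)
    show ?case
    proof
      assume z: "z \<noteq> 0"
      define p1 p2 c t where "p1 = resolvent_at_chi x1 z" and "p2 = resolvent_at_chi x2 z"
        and "c = z / (1 + z)" and "t = chi_transform \<phi> x1 z * chi_transform \<phi> x2 z / c"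
      have z_less: "cmod z < 1 / 2" "cmod z < 1 / M" "cmod z < \<delta> / M"
        using elim(9) by simp_all
      then have Mz: "M * cmod z < 1" "M * cmod z < \<delta>"
        using M by (simp_all add: pos_less_divide_eq mult.commute)
      have z1: "z \<noteq> -1"
        using z_less(1) by auto
      then have z1': "1 + z \<noteq> 0"
        by (metis add.commute add_eq_0_iff)
      have "cmod (1 + z) \<le> 1 + cmod z"
        using norm_triangle_ineq[of 1 z] by simp
      then have le2: "cmod (1 + z) < 2"
        using z_less(1) by linarith
      have pos: "0 < cmod z" "0 < cmod (1 + z)"
        using z z1' by simp_all
      have c_eq: "cmod c = cmod z / cmod (1 + z)"
        by (simp add: c_def norm_divide)
      have c_gt: "cmod z / 2 < cmod c"
        unfolding c_eq using pos le2 by (intro divide_strict_left_mono) simp_all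
      have "norm (p1 * p2) \<le> (K1 * cmod z) * (K2 * cmod z)"
        using norm_mult_ineq[of p1 p2] mult_mono[OF elim(3) elim(6)] K1(1)
        by (simp add: p1_def p2_def)
      also have "\<dots> = M * cmod z * (cmod z / 2)"
        by (simp add: M_def)
      also have "\<dots> < 1 * (cmod z / 2)"
        using Mz(1) pos(1) by (intro mult_strict_right_mono) simp_all
      finally have small: "norm (p1 * p2) < cmod c"
        using c_gt by simp
      have inv: "alg_inverse (1 - t *\<^sub>C (x1 * x2)) = (1 + z) *\<^sub>C geometric_core c p1 p2"
        using alg_inverse_product[OF z1 z elim(2) elim(5)] small
        by (simp add: p1_def p2_def c_def t_def)
      have "\<phi> (geometric_core c p1 p2) = 1"
        using elim(2,5,7,8)
        by (intro phi_geometric_core[OF small] free centred_resolvent_in_closure)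
          (simp_all add: p1_def p2_def centred_resolvent_in_closure)
      then have psi: "psi_transform \<phi> (x1 * x2) t = z"
        by (simp add: psi_transform_def h_transform_def inv scale)
      have "cmod t = cmod (chi_transform \<phi> x1 z) * cmod (chi_transform \<phi> x2 z) / cmod c"
        by (simp add: t_def norm_mult norm_divide)
      also have "\<dots> \<le> (K1 * cmod z) * (K2 * cmod z) / cmod c"
        using elim(1,4) K1(1) by (intro divide_right_mono mult_mono) simp_all
      also have "\<dots> \<le> (K1 * cmod z) * (K2 * cmod z) / (cmod z / 2)"
        using c_gt pos K1(1) K2(1) by (intro divide_left_mono mult_pos_pos) (linarith | simp)+
      also have "\<dots> = M * cmod z"
        using z by (simp add: M_def)
      \<comment> \<open>The left inverse property holds only near 0 and is used at \<open>t\<close>,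
        not at \<open>z\<close>; this is what the estimate of \<open>cmod t\<close> is for.\<close>
      finally have "chi_transform \<phi> (x1 * x2) (psi_transform \<phi> (x1 * x2) t) = t"
        using Mz(2) by (intro \<delta>(2)) simp
      then have "chi_transform \<phi> (x1 * x2) z = t"
        by (simp add: psi)
      then show "norm (resolvent_at_chi x1 z * resolvent_at_chi x2 z) < cmod (z / (1 + z)) \<and>
          alg_inverse (1 - chi_transform \<phi> (x1 * x2) z *\<^sub>C (x1 * x2)) =
            (1 + z) *\<^sub>C geometric_core (z / (1 + z)) (resolvent_at_chi x1 z) (resolvent_at_chi x2 z)"
        using inv small by (simp add: p1_def p2_def c_def)
    qed
  qed
qed

lemma alg_inverse_chi:
  assumes "z \<noteq> -1"
  shows "alg_inverse (1 - chi_transform \<phi> a z *\<^sub>C a) = (1 + z) *\<^sub>C (1 + resolvent_at_chi a z)"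
proof -
  have "1 + z \<noteq> 0"
    using assms by (metis add.commute add_eq_0_iff)
  then show ?thesis
    by (simp add: centred_resolvent_def)
qed

lemma H_transform_chi:
  assumes "z \<noteq> -1" "w \<noteq> -1" "\<phi> (resolvent_at_chi a z) = 0" "\<phi> (resolvent_at_chi b w) = 0"
  shows "H_transform \<phi> a b (chi_transform \<phi> a z) (chi_transform \<phi> b w) =
    (1 + z) * (1 + w) * (1 + \<phi> (resolvent_at_chi a z * resolvent_at_chi b w))"
  unfolding H_transform_def alg_inverse_chi[OF assms(1)] alg_inverse_chi[OF assms(2)]
  by (simp add: mult_scaleC_left mult_scaleC_right scale add one assms(3,4) distrib_left distrib_right)

end

section \<open>The rational identity and the conclusion\<close>

text \<open>With \<kappa> as below, \<open>F e = (1 - (1 - \<kappa>) / e) / \<kappa>\<close>, so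
  \<open>F (1 + Q) = (\<kappa> + Q) / (\<kappa> * (1 + Q))\<close>. Over the denominator
  \<open>\<kappa>\<^sup>2 * (1 + Q1) * (1 + Q2)\<close>, the numerator of \<open>F E\<close> factors
  as \<open>(\<kappa> + Q1) * (\<kappa> + Q2)\<close>.\<close>

lemma S_transform_algebra:
  fixes z w Q1 Q2 E :: complex
  assumes "z \<noteq> 0" "w \<noteq> 0" "1 + z \<noteq> 0" "1 + w \<noteq> 0" "1 + Q1 \<noteq> 0" "1 + Q2 \<noteq> 0"
    and E: "E * (1 - Q1 * Q2 / (z / (1 + z) * (w / (1 + w)))) = (1 + Q1) * (1 + Q2)"
  defines "F \<equiv> \<lambda>e. (z + 1) / z * ((w + 1) / w) * (1 - (1 + z + w) / ((1 + z) * (1 + w) * e))"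
  shows "F E = F (1 + Q1) * F (1 + Q2)"
proof -
  define \<kappa> where "\<kappa> = z / (1 + z) * (w / (1 + w))"
  have \<kappa>: "\<kappa> \<noteq> 0"
    using assms(1-4) by (simp add: \<kappa>_def)
  have "(z + 1) / z * ((w + 1) / w) = 1 / \<kappa>"
    using assms(1-4) by (simp add: \<kappa>_def field_simps)
  moreover have "(1 + z + w) / ((1 + z) * (1 + w)) = 1 - \<kappa>"
  proof -
    have "1 - \<kappa> = ((1 + z) * (1 + w) - z * w) / ((1 + z) * (1 + w))"
      using assms(3,4) by (simp add: \<kappa>_def diff_divide_distrib)
    also have "(1 + z) * (1 + w) - z * w = 1 + z + w"
      by (simp add: algebra_simps)
    finally show ?thesis ..
  qed
  ultimately have F: "F e = (1 - (1 - \<kappa>) / e) / \<kappa>" for e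
    unfolding F_def by (metis divide_divide_eq_left mult.left_neutral times_divide_eq_left)
  have E0: "E \<noteq> 0"
    using E assms(5,6) by auto
  have E': "E * (\<kappa> - Q1 * Q2) = \<kappa> * ((1 + Q1) * (1 + Q2))"
    using E \<kappa> unfolding \<kappa>_def[symmetric] by (simp add: field_simps)
  then have E'': "1 / E = (\<kappa> - Q1 * Q2) / (\<kappa> * ((1 + Q1) * (1 + Q2)))"
    using E0 \<kappa> assms(5,6) by (simp add: frac_eq_eq mult.commute)
  have "F E = (1 - (1 - \<kappa>) * (1 / E)) / \<kappa>"
    by (simp add: F)
  also have "\<dots> = F (1 + Q1) * F (1 + Q2)"
    unfolding E'' F using \<kappa> assms(5,6) by (simp add: divide_simps) algebra
  finally show ?thesis .
qed

theorem theorem2p1: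
  fixes \<phi> :: "'a::complex_banach_algebra_1 \<Rightarrow> complex"
    and a1 b1 a2 b2 :: 'a
  assumes "Vector_Spaces.linear scaleC scaleC \<phi>"
    and "continuous_on UNIV \<phi>"
    and "\<phi> 1 = 1"
    and "bi_free TYPE('v::complex_vector) \<phi> (a1, b1) (a2, b2)"
    and "\<phi> a1 \<noteq> 0" and "\<phi> a2 \<noteq> 0" and "\<phi> b1 \<noteq> 0" and "\<phi> b2 \<noteq> 0"
  shows "\<exists>\<epsilon>>0. \<forall>z w. z \<noteq> 0 \<and> w \<noteq> 0 \<and> cmod z < \<epsilon> \<and> cmod w < \<epsilon> \<longrightarrow>
           S_transform \<phi> (a1 * a2) (b1 * b2) z w =
           S_transform \<phi> a1 b1 z w * S_transform \<phi> a2 b2 z w"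
proof -
  interpret continuous_functional \<phi>
    by (rule continuous_functional.intro) fact+
  let ?A = "\<lambda>x. closure (complex_vector.span (range (\<lambda>j. x ^ j))) :: 'a set"
  have alt: "\<phi> (prod_list (map p ns) * prod_list (map q ks)) =
      (if ns = ks then \<Prod>i\<leftarrow>ns. \<phi> (p i * q i) else 0)"
    if "p 1 \<in> ?A a1" "p 2 \<in> ?A a2" "q 1 \<in> ?A b1" "q 2 \<in> ?A b2"
      "\<phi> (p 1) = 0" "\<phi> (p 2) = 0" "\<phi> (q 1) = 0" "\<phi> (q 2) = 0"
      "set ns \<subseteq> {1, 2}" "distinct_adj ns" "set ks \<subseteq> {1, 2}" "distinct_adj ks"
    for p q :: "nat \<Rightarrow> 'a" and ns ks
  proof -
    define a b where "a k = (if k = 1 then a1 else a2)" and "b k = (if k = 1 then b1 else b2)" for k :: nat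
    have ab: "a 1 = a1" "a 2 = a2" "b 1 = b1" "b 2 = b2"
      by (simp_all add: a_def b_def)
    show ?thesis
    proof (rule bi_free_alternating_moment[OF assms(1-3), of a b p q ns ks])
      show "bi_free TYPE('v) \<phi> (a 1, b 1) (a 2, b 2)"
        unfolding ab by (rule assms(4))
    qed (use that ab in \<open>auto simp del: One_nat_def\<close>)
  qed
  define pair :: "'a \<Rightarrow> 'a \<Rightarrow> nat \<Rightarrow> 'a" where "pair x y k = (if k = 1 then x else y)" for x y k
  have pair: "pair x y 1 = x" "pair x y 2 = y" for x y
    by (simp_all add: pair_def)
  \<comment> \<open>The element 0 is centred and lies in every such closure, so it can fill one side
    when only words of the other side matter.\<close>
  have zero_in: "0 \<in> ?A x" for x
    by (intro subsetD[OF closure_subset] complex_vector.span_zero)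
  have diagonal: "\<phi> (alternating_power m p1 p2 * alternating_power n q1 q2) =
        (if m = n then (\<phi> (p1 * q1) * \<phi> (p2 * q2)) ^ n * ((1 + \<phi> (p1 * q1)) * (1 + \<phi> (p2 * q2))) else 0)"
      "\<phi> (alternating_power n p1 p2) = (if n = 0 then 1 else 0)"
      "\<phi> (alternating_power n q1 q2) = (if n = 0 then 1 else 0)"
      "\<phi> (p1 * p2) = 0" "\<phi> (q1 * q2) = 0"
    if "p1 \<in> ?A a1" "p2 \<in> ?A a2" "q1 \<in> ?A b1" "q2 \<in> ?A b2"
      "\<phi> p1 = 0" "\<phi> p2 = 0" "\<phi> q1 = 0" "\<phi> q2 = 0" for p1 p2 q1 q2 m n
  proof -
    have *: "\<phi> (prod_list (map (pair p1 p2) ns) * prod_list (map (pair q1 q2) ks)) =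
        (if ns = ks then \<Prod>i\<leftarrow>ns. \<phi> (pair p1 p2 i * pair q1 q2 i) else 0)"
      if "set ns \<subseteq> {1, 2}" "distinct_adj ns" "set ks \<subseteq> {1, 2}" "distinct_adj ks" for ns ks
      by (rule alt) (use pair that \<open>p1 \<in> _\<close> \<open>p2 \<in> _\<close> \<open>q1 \<in> _\<close> \<open>q2 \<in> _\<close> \<open>\<phi> p1 = 0\<close> \<open>\<phi> p2 = 0\<close>
          \<open>\<phi> q1 = 0\<close> \<open>\<phi> q2 = 0\<close> in simp_all)
    show "\<phi> (alternating_power m p1 p2 * alternating_power n q1 q2) =
        (if m = n then (\<phi> (p1 * q1) * \<phi> (p2 * q2)) ^ n * ((1 + \<phi> (p1 * q1)) * (1 + \<phi> (p2 * q2))) else 0)"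
      using alternating_diagonal(1)[of "pair p1 p2" "pair q1 q2" m n, OF *] unfolding pair .
    show "\<phi> (alternating_power n p1 p2) = (if n = 0 then 1 else 0)"
      using alternating_diagonal(2)[of "pair p1 p2" "pair q1 q2" n, OF *] unfolding pair .
    show "\<phi> (alternating_power n q1 q2) = (if n = 0 then 1 else 0)"
      using alternating_diagonal(3)[of "pair p1 p2" "pair q1 q2" n, OF *] unfolding pair .
    show "\<phi> (p1 * p2) = 0" "\<phi> (q1 * q2) = 0"
      using *[of "[1, 2]" "[]"] *[of "[]" "[1, 2]"] by (simp_all add: pair_def)
  qed
  have centred: "x - \<phi> x *\<^sub>C 1 \<in> ?A x" "\<phi> (x - \<phi> x *\<^sub>C 1) = 0" for x
  proof -
    have "x \<in> range (\<lambda>j. x ^ j)" "1 \<in> range (\<lambda>j. x ^ j)"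
      by (rule image_eqI[of _ _ 1] image_eqI[of _ _ 0]; simp)+
    then show "x - \<phi> x *\<^sub>C 1 \<in> ?A x"
      by (intro subsetD[OF closure_subset] complex_vector.span_diff complex_vector.span_scale
          complex_vector.span_base)
    show "\<phi> (x - \<phi> x *\<^sub>C 1) = 0"
      by (simp add: diff scale one)
  qed
  have expand: "\<phi> ((x - \<phi> x *\<^sub>C 1) * (y - \<phi> y *\<^sub>C 1)) = \<phi> (x * y) - \<phi> x * \<phi> y" for x y
    by (simp add: left_diff_distrib right_diff_distrib mult_scaleC_left mult_scaleC_right diff scale one)
  \<comment> \<open>The two-letter word in the centred variables has state 0. The resulting nonzero
    values provide local inverse functions for the products.\<close>
  have "\<phi> (a1 * a2) = \<phi> a1 * \<phi> a2" "\<phi> (b1 * b2) = \<phi> b1 * \<phi> b2"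
    using diagonal(4)[OF centred(1) centred(1) zero_in zero_in centred(2) centred(2) zero zero]
      diagonal(5)[OF zero_in zero_in centred(1) centred(1) zero zero centred(2) centred(2)]
    unfolding expand by simp_all
  then have prod: "\<phi> (a1 * a2) \<noteq> 0" "\<phi> (b1 * b2) \<noteq> 0"
    using assms(5-8) by simp_all
  note A = alg_inverse_chi_product[OF assms(5,6) prod(1)
      diagonal(2)[OF _ _ zero_in zero_in _ _ zero zero]]
  note B = alg_inverse_chi_product[OF assms(7,8) prod(2)
      diagonal(3)[OF zero_in zero_in _ _ zero zero]]
  \<comment> \<open>Bounding the left resolvents by \<delta> and the right ones by 1 makes
    \<open>\<phi> (p\<^sub>i * q\<^sub>i)\<close> smaller than 1 in modulus, so
    \<open>1 + \<phi> (p\<^sub>i * q\<^sub>i)\<close> does not vanish. Hence the different first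
    arguments of \<open>good\<close> below.\<close>
  obtain \<delta> where \<delta>: "\<delta> > 0" "\<And>x. norm x < \<delta> \<Longrightarrow> cmod (\<phi> x) < 1"
  proof -
    have "isCont \<phi> 0"
      using assms(2) by (simp add: continuous_on_eq_continuous_at)
    then show thesis
      using that unfolding continuous_at_eps_delta zero by (metis diff_zero dist_norm zero_less_one)
  qed
  have left: "\<forall>\<^sub>F z in nhds 0. norm (resolvent_at_chi x z) < e \<and> \<phi> (resolvent_at_chi x z) = 0 \<and>
      resolvent_at_chi x z \<in> ?A x" if nonzero: "\<phi> x \<noteq> 0" and "0 < e" for x e
  proof -
    obtain K where K: "K > 0" "\<forall>\<^sub>F z in nhds 0. norm (chi_transform \<phi> x z *\<^sub>C x) < 1"
      "\<forall>\<^sub>F z in nhds 0. norm (resolvent_at_chi x z) \<le> K * cmod z"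
      using resolvent_at_chi_small[OF nonzero] by metis
    from K(2) eventually_linear_bound_less[OF K(3,1) \<open>0 < e\<close>] phi_resolvent_at_chi[OF nonzero]
    show ?thesis
      by eventually_elim (simp add: centred_resolvent_in_closure)
  qed
  define good :: "real \<Rightarrow> 'a \<Rightarrow> 'a \<Rightarrow> complex \<Rightarrow> bool" where
    "good e x y z \<longleftrightarrow> cmod z < 1 \<and>
      (norm (resolvent_at_chi x z) < e \<and> \<phi> (resolvent_at_chi x z) = 0 \<and> resolvent_at_chi x z \<in> ?A x) \<and>
      (norm (resolvent_at_chi y z) < e \<and> \<phi> (resolvent_at_chi y z) = 0 \<and> resolvent_at_chi y z \<in> ?A y) \<and>
      (z \<noteq> 0 \<longrightarrow> norm (resolvent_at_chi x z * resolvent_at_chi y z) < cmod (z / (1 + z)) \<and>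
        alg_inverse (1 - chi_transform \<phi> (x * y) z *\<^sub>C (x * y)) =
          (1 + z) *\<^sub>C geometric_core (z / (1 + z)) (resolvent_at_chi x z) (resolvent_at_chi y z))"
    for e x y z
  have "\<forall>\<^sub>F z in nhds 0. good \<delta> a1 a2 z"
    unfolding good_def
    by (intro eventually_conj eventually_norm_less left A) (use assms \<delta>(1) in simp_all)
  moreover have "\<forall>\<^sub>F w in nhds 0. good 1 b1 b2 w"
    unfolding good_def
    by (intro eventually_conj eventually_norm_less left B) (use assms in simp_all)
  ultimately obtain \<epsilon> \<epsilon>' where \<epsilon>: "\<epsilon> > 0" "\<epsilon>' > 0" "\<And>z. cmod z < \<epsilon> \<Longrightarrow> good \<delta> a1 a2 z"
    "\<And>w. cmod w < \<epsilon>' \<Longrightarrow> good 1 b1 b2 w"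
    unfolding eventually_nhds_metric dist_norm diff_zero by metis
  have main: "S_transform \<phi> (a1 * a2) (b1 * b2) z w = S_transform \<phi> a1 b1 z w * S_transform \<phi> a2 b2 z w"
    if z: "z \<noteq> 0" "good \<delta> a1 a2 z" and w: "w \<noteq> 0" "good 1 b1 b2 w" for z w
  proof -
    define p1 p2 q1 q2 where "p1 = resolvent_at_chi a1 z" and "p2 = resolvent_at_chi a2 z"
      and "q1 = resolvent_at_chi b1 w" and "q2 = resolvent_at_chi b2 w"
    define c d where "c = z / (1 + z)" and "d = w / (1 + w)"
    define E where "E = \<phi> (geometric_core c p1 p2 * geometric_core d q1 q2)"
    note defs = p1_def p2_def q1_def q2_def c_def d_def
    have p: "norm p1 < \<delta>" "\<phi> p1 = 0" "p1 \<in> ?A a1" "norm p2 < \<delta>" "\<phi> p2 = 0" "p2 \<in> ?A a2"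
      "norm (p1 * p2) < cmod c" "cmod z < 1"
      "alg_inverse (1 - chi_transform \<phi> (a1 * a2) z *\<^sub>C (a1 * a2)) = (1 + z) *\<^sub>C geometric_core c p1 p2"
      using z unfolding good_def defs by blast+
    have q: "norm q1 < 1" "\<phi> q1 = 0" "q1 \<in> ?A b1" "norm q2 < 1" "\<phi> q2 = 0" "q2 \<in> ?A b2"
      "norm (q1 * q2) < cmod d" "cmod w < 1"
      "alg_inverse (1 - chi_transform \<phi> (b1 * b2) w *\<^sub>C (b1 * b2)) = (1 + w) *\<^sub>C geometric_core d q1 q2"
      using w unfolding good_def defs by blast+
    have nz: "1 + \<phi> (x * y) \<noteq> 0" if "norm x < \<delta>" "norm y < 1" for x y
    proof
      have "norm (x * y) \<le> norm x * norm y"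
        by (rule norm_mult_ineq)
      also have "\<dots> \<le> norm x * 1"
        using that(2) by (intro mult_left_mono) simp_all
      finally have "cmod (\<phi> (x * y)) < 1"
        using that(1) by (intro \<delta>(2)) simp
      moreover assume "1 + \<phi> (x * y) = 0"
      then have "\<phi> (x * y) = -1"
        by (simp add: add_eq_0_iff)
      ultimately show False
        by simp
    qed
    have z1: "z \<noteq> -1" and w1: "w \<noteq> -1"
      using p(8) q(8) by auto
    then have z1': "1 + z \<noteq> 0" and w1': "1 + w \<noteq> 0"
      by (metis add.commute add_eq_0_iff)+
    have "E * (1 - \<phi> (p1 * q1) * \<phi> (p2 * q2) / (c * d)) = (1 + \<phi> (p1 * q1)) * (1 + \<phi> (p2 * q2))"
      unfolding E_def
      by (rule phi_geometric_core_mult[OF p(7) q(7)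
            diagonal(1)[OF p(3) p(6) q(3) q(6) p(2) p(5) q(2) q(5)]])
    from S_transform_algebra[OF z(1) w(1) z1' w1' nz[OF p(1) q(1)] nz[OF p(4) q(4)]
        this[unfolded c_def d_def]]
    have key: "(z + 1) / z * ((w + 1) / w) * (1 - (1 + z + w) / ((1 + z) * (1 + w) * E)) =
      (z + 1) / z * ((w + 1) / w) * (1 - (1 + z + w) / ((1 + z) * (1 + w) * (1 + \<phi> (p1 * q1)))) *
      ((z + 1) / z * ((w + 1) / w) * (1 - (1 + z + w) / ((1 + z) * (1 + w) * (1 + \<phi> (p2 * q2)))))" .
    have H: "H_transform \<phi> (a1 * a2) (b1 * b2) (chi_transform \<phi> (a1 * a2) z) (chi_transform \<phi> (b1 * b2) w) =
        (1 + z) * (1 + w) * E"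
      by (simp add: H_transform_def p(9) q(9) mult_scaleC_left mult_scaleC_right scale E_def)
    have H1: "H_transform \<phi> a1 b1 (chi_transform \<phi> a1 z) (chi_transform \<phi> b1 w) =
        (1 + z) * (1 + w) * (1 + \<phi> (p1 * q1))"
      using H_transform_chi[OF z1 w1 p(2)[unfolded p1_def] q(2)[unfolded q1_def]]
      by (simp only: p1_def q1_def)
    have H2: "H_transform \<phi> a2 b2 (chi_transform \<phi> a2 z) (chi_transform \<phi> b2 w) =
        (1 + z) * (1 + w) * (1 + \<phi> (p2 * q2))"
      using H_transform_chi[OF z1 w1 p(5)[unfolded p2_def] q(5)[unfolded q2_def]]
      by (simp only: p2_def q2_def)
    show ?thesis
      unfolding S_transform_def H H1 H2 by (rule key)
  qed
  show ?thesis
  proof (intro exI[of _ "min \<epsilon> \<epsilon>'"] conjI allI impI)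
    show "0 < min \<epsilon> \<epsilon>'"
      using \<epsilon>(1,2) by simp
    fix z w
    assume "z \<noteq> 0 \<and> w \<noteq> 0 \<and> cmod z < min \<epsilon> \<epsilon>' \<and> cmod w < min \<epsilon> \<epsilon>'"
    then show "S_transform \<phi> (a1 * a2) (b1 * b2) z w = S_transform \<phi> a1 b1 z w * S_transform \<phi> a2 b2 z w"
      by (intro main \<epsilon>(3,4)) simp_all
  qed
qed

end
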